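(* Let $(\Omega,\mathcal{H},\hat{\mathbb{E}})$ be a regular sublinear expectation space with representing set of probability measures $\mathcal{P}$ and upper capacity $\hat V$. Let $n,d\ge 1$ and let $\{X_i\}_{i=1}^n\subset L^2(\Omega;\mathbb{R}^d)$ be independent under $\hat{\mathbb{E}}$ with $|X_i|\le M$ a.s. for all $i\le n$, where $M>0$ is a constant. Then for every $t>0$, \[ \hat V\!\left(\rho_\Theta\!\left(\frac1n\sum_{i=1}^n X_i\right)>t\right)\le 2\cdot 5^d\,\exp\!\left(-\frac{nt^2}{8\bar\sigma_n^2+\frac{8Mt}{3}}\right). \]
   Context: $\Omega$ is a complete separable metric space and $\mathcal{H}=C_{b.\mathrm{Lip}}(\Omega)$ is the space of bounded Lipschitz real functions on $\Omega$. A regular sublinear expectation is a functional $\hat{\mathbb{E}}:\mathcal{H}\to\mathbb{R}$ that is monotone, constant preserving, subadditive and positively homogeneous, and such that $X_k\in\mathcal{H}$, $X_k\downarrow 0$ implies $\hat{\mathbb{E}}[X_k]\downarrow 0$. By a known representation theorem there is a convex, weakly compact set $\mathcal{P}$ of probability measures on $(\Omega,\mathcal{B}(\Omega))$ with $\hat{\mathbb{E}}[X]=\sup_{P\in\mathcal{P}}E_P[X]$ for $X\in\mathcal{H}$; fix this $\mathcal{P}$. The upper capacity is $\hat V(A)=\sup_{P\in\mathcal{P}}P(A)$. $L^p(\Omega)$ is the completion of $\mathcal{H}$ under $\|X\|_p=(\hat{\mathbb{E}}[|X|^p])^{1/p}$, and $L^p(\Omega;\mathbb{R}^d)$ denotes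 $\mathbb{R}^d$-valued vectors with components in $L^p(\Omega)$; $\hat{\mathbb{E}}$ and the representation extend to $L^1(\Omega)$. "a.s." without a specified measure means $P$-a.s. for every $P\in\mathcal{P}$. Independence: $\{X_i\}_{i=1}^n\subset L^1(\Omega;\mathbb{R}^d)$ is independent under $\hat{\mathbb{E}}$ if for each $1\le i\le n-1$ and every $\psi\in C_{b.\mathrm{Lip}}(\mathbb{R}^{d(i+1)})$, $\hat{\mathbb{E}}[\psi(X_1,\dots,X_i,X_{i+1})]=\hat{\mathbb{E}}\big[\hat{\mathbb{E}}[\psi(x_1,\dots,x_i,X_{i+1})]\big|_{(x_1,\dots,x_i)=(X_1,\dots,X_i)}\big]$. $|\cdot|$ and $\langle\cdot,\cdot\rangle$ are the Euclidean norm and inner product. For each $i$, $\Theta_i=\{\theta\in\mathbb{R}^d:\langle\theta,p\rangle\le\hat{\mathbb{E}}[\langle p,X_i\rangle]\ \forall p\in\mathbb{R}^d\}$, a convex compact set, known to equal $\{E_P[X_i]:P\in\mathcal{P}\}$ for independent $X_i$ in $L^2$. Further, $\Theta=\{\frac1n\sum_{i=1}^n\theta_i:\theta_i\in\Theta_i\}$, $\rho_\Theta(x)=\inf_{\theta\in\Theta}|x-\theta|$, and $\bar\sigma_n^2=\sup_{i\le n}\inf_{\theta_i\in\Theta_i}\hat{\mathbb{E}}[|X_i-\theta_i|^2]$. *)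

theory Defs
  imports "HOL-Probability.Probability"
begin

definition cb_Lip :: "('a::metric_space \<Rightarrow> real) set" where
  "cb_Lip = {f. bounded (range f) \<and> (\<exists>L. lipschitz_on L UNIV f)}"

definition sublinear_expectation :: "(('a::metric_space \<Rightarrow> real) \<Rightarrow> real) \<Rightarrow> bool" where
  "sublinear_expectation E \<longleftrightarrow>
     (\<forall>X\<in>cb_Lip. \<forall>Y\<in>cb_Lip. (\<forall>\<omega>. X \<omega> \<le> Y \<omega>) \<longrightarrow> E X \<le> E Y) \<and>
     (\<forall>c. E (\<lambda>_. c) = c) \<and>
     (\<forall>X\<in>cb_Lip. \<forall>Y\<in>cb_Lip. E (\<lambda>\<omega>. X \<omega> + Y \<omega>) \<le> E X + E Y) \<and>
     (\<forall>X\<in>cb_Lip. \<forall>c\<ge>0. E (\<lambda>\<omega>. c * X \<omega>) = c * E X)"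

definition regular_sublinear_expectation :: "(('a::metric_space \<Rightarrow> real) \<Rightarrow> real) \<Rightarrow> bool" where
  "regular_sublinear_expectation E \<longleftrightarrow>
     sublinear_expectation E \<and>
     (\<forall>X. (\<forall>k. X k \<in> cb_Lip) \<and> (\<forall>\<omega>. decseq (\<lambda>k. X k \<omega>)) \<and> (\<forall>\<omega>. (\<lambda>k. X k \<omega>) \<longlonglongrightarrow> 0) \<longrightarrow>
          decseq (\<lambda>k. E (X k)) \<and> (\<lambda>k. E (X k)) \<longlonglongrightarrow> 0)"

text \<open>The weak topology on the Borel probability measures: the coarsest one making
  \<open>P \<mapsto> E_P[f]\<close> continuous for every bounded continuous \<open>f\<close>.\<close>

definition weak_topology :: "'a::topological_space measure topology" where
  "weak_topology = topology_generated_by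
     {{P \<in> space (prob_algebra borel). (\<integral>\<omega>. f \<omega> \<partial>P) \<in> U} | f U.
        continuous_on UNIV (f :: 'a \<Rightarrow> real) \<and> bounded (range f) \<and> open U}"

definition convex_measures :: "'a::topological_space measure set \<Rightarrow> bool" where
  "convex_measures \<P> \<longleftrightarrow>
     (\<forall>P\<in>\<P>. \<forall>Q\<in>\<P>. \<forall>u\<in>{0..1::real}. \<exists>R\<in>\<P>. \<forall>A\<in>sets borel.
        measure R A = u * measure P A + (1 - u) * measure Q A)"

definition represents ::
    "'a::metric_space measure set \<Rightarrow> (('a \<Rightarrow> real) \<Rightarrow> real) \<Rightarrow> bool" where
  "represents \<P> E \<longleftrightarrow>
     \<P> \<subseteq> space (prob_algebra borel) \<and> convex_measures \<P> \<and> compactin weak_topology \<P> \<and>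
     (\<forall>X\<in>cb_Lip. E X = (SUP P\<in>\<P>. \<integral>\<omega>. X \<omega> \<partial>P))"

definition upper_capacity :: "'a measure set \<Rightarrow> 'a set \<Rightarrow> real" where
  "upper_capacity \<P> A = (SUP P\<in>\<P>. measure P A)"

text \<open>The \<open>p\<close>-th power of the norm, for arbitrary Borel functions (hence possibly infinite).
  On \<open>cb_Lip\<close> the representation turns it into \<open>E[|X|^p]\<close>.\<close>

definition upper_moment :: "'a measure set \<Rightarrow> real \<Rightarrow> ('a \<Rightarrow> real) \<Rightarrow> ennreal" where
  "upper_moment \<P> p X = (SUP P\<in>\<P>. \<integral>\<^sup>+\<omega>. ennreal (\<bar>X \<omega>\<bar> powr p) \<partial>P)"

definition Lp_approx ::
    "'a::metric_space measure set \<Rightarrow> real \<Rightarrow> (nat \<Rightarrow> 'a \<Rightarrow> real) \<Rightarrow> ('a \<Rightarrow> real) \<Rightarrow> bool" where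
  "Lp_approx \<P> p S X \<longleftrightarrow>
     (\<forall>k. S k \<in> cb_Lip) \<and> (\<lambda>k. upper_moment \<P> p (\<lambda>\<omega>. S k \<omega> - X \<omega>)) \<longlonglongrightarrow> 0"

text \<open>The completion of \<open>cb_Lip\<close>, realised by Borel functions: every element of the abstract
  completion has such a representative, unique up to equality \<open>P\<close>-a.s. for all \<open>P \<in> \<P>\<close>.
  No quotient is taken.\<close>

definition Lp_space :: "'a::metric_space measure set \<Rightarrow> real \<Rightarrow> ('a \<Rightarrow> real) set" where
  "Lp_space \<P> p = {X \<in> borel_measurable borel. \<exists>S. Lp_approx \<P> p S X}"

definition Lp_space_vec ::
    "'a::metric_space measure set \<Rightarrow> real \<Rightarrow> ('a \<Rightarrow> real^'d) set" where
  "Lp_space_vec \<P> p = {X. \<forall>j. (\<lambda>\<omega>. X \<omega> $ j) \<in> Lp_space \<P> p}"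

text \<open>The extension of \<open>E\<close> to \<open>Lp_space \<P> 1\<close> by continuity.\<close>

definition extension ::
    "'a::metric_space measure set \<Rightarrow> (('a \<Rightarrow> real) \<Rightarrow> real) \<Rightarrow> ('a \<Rightarrow> real) \<Rightarrow> real" where
  "extension \<P> E X = (THE l. \<forall>S. Lp_approx \<P> 1 S X \<longrightarrow> (\<lambda>k. E (S k)) \<longlonglongrightarrow> l)"

lemma cb_Lip_measurable:
  assumes "f \<in> cb_Lip" shows "f \<in> borel_measurable borel"
proof -
  obtain L where "lipschitz_on L UNIV f" using assms by (auto simp: cb_Lip_def)
  then have "continuous_on UNIV f" by (rule lipschitz_on_continuous_on)
  then show ?thesis by (rule borel_measurable_continuous_onI)
qed

lemma extension_limit:
  assumes rep: "represents \<P> E" and ne: "\<P> \<noteq> {}" and X: "X \<in> borel_measurable borel"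
    and S: "Lp_approx \<P> 1 S X"
  shows "(\<lambda>k. E (S k)) \<longlonglongrightarrow> (SUP P\<in>\<P>. \<integral>\<omega>. X \<omega> \<partial>P)"
proof -
  define m where "m k = upper_moment \<P> 1 (\<lambda>\<omega>. S k \<omega> - X \<omega>)" for k
  have m0: "m \<longlonglongrightarrow> 0" and SH: "S k \<in> cb_Lip" for k
    using S by (auto simp: Lp_approx_def m_def[abs_def])
  have ev: "eventually (\<lambda>k. m k < 1) sequentially"
    using m0 by (rule order_tendstoD) simp
  have main: "\<bar>E (S k) - (SUP P\<in>\<P>. \<integral>\<omega>. X \<omega> \<partial>P)\<bar> \<le> enn2real (m k)" if mk: "m k < 1" for k
  proof -
    obtain B where B: "\<And>\<omega>. \<bar>S k \<omega>\<bar> \<le> B"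
      using SH[of k] by (auto simp: cb_Lip_def bounded_iff)
    note Sm = cb_Lip_measurable[OF SH[of k]]
    have P1: "\<bar>(\<integral>\<omega>. S k \<omega> \<partial>P) - (\<integral>\<omega>. X \<omega> \<partial>P)\<bar> \<le> enn2real (m k)"
      and P2: "\<bar>\<integral>\<omega>. S k \<omega> \<partial>P\<bar> \<le> B" if P: "P \<in> \<P>" for P
    proof -
      from P rep have pP: "prob_space P" and sP: "sets P = sets borel"
        by (auto simp: represents_def space_prob_algebra)
      interpret prob_space P by fact
      have [measurable]: "S k \<in> borel_measurable P" "X \<in> borel_measurable P"
        using Sm X by (simp_all add: measurable_cong_sets[OF sP refl])
      have iS: "integrable P (S k)"
        by (rule integrable_const_bound[where B=B]) (auto simp: B)
      have le: "(\<integral>\<^sup>+\<omega>. ennreal \<bar>S k \<omega> - X \<omega>\<bar> \<partial>P) \<le> m k"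
        unfolding m_def upper_moment_def by (rule SUP_upper2[OF P]) simp
      have iD: "integrable P (\<lambda>\<omega>. S k \<omega> - X \<omega>)"
        by (rule integrableI_bounded) (use le mk in \<open>auto intro: le_less_trans order_less_trans\<close>)
      have iX: "integrable P X"
        using Bochner_Integration.integrable_diff[OF iS iD] by simp
      have "\<bar>(\<integral>\<omega>. S k \<omega> \<partial>P) - (\<integral>\<omega>. X \<omega> \<partial>P)\<bar> = \<bar>\<integral>\<omega>. S k \<omega> - X \<omega> \<partial>P\<bar>"
        using iS iX by simp
      also have "\<dots> \<le> (\<integral>\<omega>. \<bar>S k \<omega> - X \<omega>\<bar> \<partial>P)" by (rule integral_abs_bound)
      also have "\<dots> = enn2real (\<integral>\<^sup>+\<omega>. ennreal \<bar>S k \<omega> - X \<omega>\<bar> \<partial>P)"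
        by (rule integral_eq_nn_integral) auto
      also have "\<dots> \<le> enn2real (m k)"
        using le mk by (intro enn2real_mono) (auto intro: order_less_trans)
      finally show "\<bar>(\<integral>\<omega>. S k \<omega> \<partial>P) - (\<integral>\<omega>. X \<omega> \<partial>P)\<bar> \<le> enn2real (m k)" .
      have "\<bar>\<integral>\<omega>. S k \<omega> \<partial>P\<bar> \<le> (\<integral>\<omega>. \<bar>S k \<omega>\<bar> \<partial>P)" by (rule integral_abs_bound)
      also have "\<dots> \<le> B" using iS by (intro integral_le_const) (auto simp: B)
      finally show "\<bar>\<integral>\<omega>. S k \<omega> \<partial>P\<bar> \<le> B" .
    qed
    let ?s = "\<lambda>P. \<integral>\<omega>. S k \<omega> \<partial>P" and ?x = "\<lambda>P. \<integral>\<omega>. X \<omega> \<partial>P"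
    have bs: "bdd_above (?s ` \<P>)" using P2 by (auto intro!: bdd_aboveI[of _ B] dest: abs_le_D1)
    have x_le: "?x P \<le> B + enn2real (m k)" if "P \<in> \<P>" for P
      using P1[OF that] P2[OF that] by linarith
    then have bx: "bdd_above (?x ` \<P>)" by (auto intro!: bdd_aboveI)
    have "(SUP P\<in>\<P>. ?s P) \<le> (SUP P\<in>\<P>. ?x P) + enn2real (m k)"
    proof (rule cSUP_least[OF ne])
      fix P assume "P \<in> \<P>"
      then show "?s P \<le> (SUP P\<in>\<P>. ?x P) + enn2real (m k)"
        using P1[of P] cSUP_upper[OF _ bx, of P] by linarith
    qed
    moreover have "(SUP P\<in>\<P>. ?x P) \<le> (SUP P\<in>\<P>. ?s P) + enn2real (m k)"
    proof (rule cSUP_least[OF ne])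
      fix P assume "P \<in> \<P>"
      then show "?x P \<le> (SUP P\<in>\<P>. ?s P) + enn2real (m k)"
        using P1[of P] cSUP_upper[OF _ bs, of P] by linarith
    qed
    moreover have "E (S k) = (SUP P\<in>\<P>. ?s P)" using rep SH by (simp add: represents_def)
    ultimately show ?thesis by linarith
  qed
  have "(\<lambda>k. enn2real (m k)) \<longlonglongrightarrow> 0"
    by (rule tendsto_enn2real) (use m0 in simp_all)
  then have "(\<lambda>k. E (S k) - (SUP P\<in>\<P>. \<integral>\<omega>. X \<omega> \<partial>P)) \<longlonglongrightarrow> 0"
    by (rule Lim_null_comparison[rotated]) (use ev in \<open>eventually_elim, auto intro: main\<close>)
  then show ?thesis by (simp add: LIM_zero_iff)
qed

text \<open>Well-definedness of \<open>extension\<close>; the representation extends with it.\<close>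

lemma extension_eq_SUP:
  assumes "represents \<P> E" "sublinear_expectation E" "X \<in> Lp_space \<P> 1"
  shows "extension \<P> E X = (SUP P\<in>\<P>. \<integral>\<omega>. X \<omega> \<partial>P)"
proof -
  have ne: "\<P> \<noteq> {}"
  proof
    assume "\<P> = {}"
    moreover have "(\<lambda>_. c) \<in> cb_Lip" for c by (auto simp: cb_Lip_def intro: lipschitz_intros)
    ultimately have "E (\<lambda>_. c) = Sup {}" for c
      using assms(1) unfolding represents_def by auto
    then have "E (\<lambda>_. 0) = E (\<lambda>_. 1)" by simp
    with assms(2) show False by (simp add: sublinear_expectation_def)
  qed
  obtain S where S: "Lp_approx \<P> 1 S X" and X: "X \<in> borel_measurable borel"
    using assms(3) by (auto simp: Lp_space_def)
  note lim = extension_limit[OF assms(1) ne X]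
  show ?thesis unfolding extension_def
    by (rule the_equality) (use lim S in \<open>blast intro: LIMSEQ_unique\<close>)+
qed

text \<open>Functions in \<open>C_b.Lip(R^(d k))\<close>, as functions of a sequence of vectors. The Lipschitz
  condition, for the Euclidean norm on coordinates \<open>1..k\<close>, forces dependence on these only.\<close>

definition cb_Lip_prefix :: "nat \<Rightarrow> ((nat \<Rightarrow> real^'d) \<Rightarrow> real) set" where
  "cb_Lip_prefix k = {\<psi>. bounded (range \<psi>) \<and>
     (\<exists>L. \<forall>x y. \<bar>\<psi> x - \<psi> y\<bar> \<le> L * L2_set (\<lambda>j. norm (x j - y j)) {1..k})}"

definition independent_seq ::
    "'a::metric_space measure set \<Rightarrow> (('a \<Rightarrow> real) \<Rightarrow> real) \<Rightarrow> nat \<Rightarrow> (nat \<Rightarrow> 'a \<Rightarrow> real^'d) \<Rightarrow> bool" where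
  "independent_seq \<P> E n X \<longleftrightarrow>
     (\<forall>i. 1 \<le> i \<and> i < n \<longrightarrow> (\<forall>\<psi>\<in>cb_Lip_prefix (i + 1).
        extension \<P> E (\<lambda>\<omega>. \<psi> (\<lambda>j. X j \<omega>)) =
        extension \<P> E (\<lambda>\<omega>. extension \<P> E (\<lambda>\<omega>'. \<psi> ((\<lambda>j. X j \<omega>)(i + 1 := X (i + 1) \<omega>'))))))"

definition mean_set ::
    "'a::metric_space measure set \<Rightarrow> (('a \<Rightarrow> real) \<Rightarrow> real) \<Rightarrow> ('a \<Rightarrow> real^'d) \<Rightarrow> (real^'d) set" where
  "mean_set \<P> E Y = {\<theta>. \<forall>p. \<theta> \<bullet> p \<le> extension \<P> E (\<lambda>\<omega>. p \<bullet> Y \<omega>)}"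

definition avg_mean_set ::
    "'a::metric_space measure set \<Rightarrow> (('a \<Rightarrow> real) \<Rightarrow> real) \<Rightarrow> nat \<Rightarrow> (nat \<Rightarrow> 'a \<Rightarrow> real^'d) \<Rightarrow> (real^'d) set" where
  "avg_mean_set \<P> E n X =
     {(1 / real n) *\<^sub>R (\<Sum>i=1..n. \<theta> i) | \<theta>. \<forall>i\<in>{1..n}. \<theta> i \<in> mean_set \<P> E (X i)}"

definition max_variance ::
    "'a::metric_space measure set \<Rightarrow> (('a \<Rightarrow> real) \<Rightarrow> real) \<Rightarrow> nat \<Rightarrow> (nat \<Rightarrow> 'a \<Rightarrow> real^'d) \<Rightarrow> real" where
  "max_variance \<P> E n X =
     (SUP i\<in>{1..n}. INF \<theta>\<in>mean_set \<P> E (X i). extension \<P> E (\<lambda>\<omega>. (norm (X i \<omega> - \<theta>))\<^sup>2))"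

end

theory Submission
  imports Defs
begin

text \<open>
  If the average deviates from \<open>\<Theta>\<close> by more than \<open>t\<close>, then for every selection of means \<open>\<theta>\<^sub>i \<in> \<Theta>\<^sub>i\<close>
  some direction \<open>q\<close> of a half-net of the unit ball (of cardinality at most \<open>5\<^sup>d\<close>) sees
  \<open>\<langle>q, \<Sum>\<^sub>i (X\<^sub>i - \<theta>\<^sub>i)\<rangle> \<ge> n t / 2\<close>. Hence the deviation forces the potential
  \<open>U\<^sub>n = inf\<^bsub>\<theta>\<^esub> \<Sum>\<^sub>q exp (\<lambda> \<langle>q, \<Sum>\<^sub>i (X\<^sub>i - \<theta>\<^sub>i)\<rangle>)\<close> to be at least \<open>exp (\<lambda> n t / 2)\<close>.
  By independence the last vector may be integrated with the others frozen. Under each \<open>P \<in> \<P>\<close>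
  its mean \<open>E\<^sub>P[X\<^sub>n]\<close> is an admissible choice of \<open>\<theta>\<^sub>n\<close>, so Bernstein's exponential moment bound yields
  \<open>E[U\<^sub>n] \<le> C E[U\<^sub>n\<^sub>-\<^sub>1]\<close>, without any conditional expectations. Iterating, Markov's inequality and the
  optimal \<open>\<lambda>\<close> give the claim.
\<close>

section \<open>Bernstein estimates and half-nets\<close>

text \<open>Every factor of the factorial beyond 2 is at least 3. This compares the tail of the
  exponential series with a geometric series.\<close>

lemma fact_ge_two_times_three_power: "2 * 3 ^ k \<le> (fact (k + 2) :: real)"
proof (induction k)
  case (Suc k)
  have "2 * 3 ^ Suc k = 3 * (2 * 3 ^ k :: real)" by simp
  also have "\<dots> \<le> real (Suc (k + 2)) * fact (k + 2)"
    using Suc by (intro mult_mono) auto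
  finally show ?case by (simp add: algebra_simps)
qed (simp add: eval_nat_numeral)

text \<open>From its quadratic term on, the series of \<open>exp x\<close> is dominated term by term
  by \<open>x\<^sup>2 / 2\<close> times the powers of \<open>c / 3\<close>; the condition
  \<open>c < 3\<close> makes this geometric series converge.\<close>

lemma exp_le_bernstein:
  fixes x c :: real
  assumes x: "\<bar>x\<bar> \<le> c" and c: "c < 3"
  shows "exp x \<le> 1 + x + x\<^sup>2 / (2 * (1 - c / 3))"
proof -
  have c0: "0 \<le> c" using x by linarith
  have geo: "(\<lambda>k. x\<^sup>2 / 2 * (c / 3) ^ k) sums (x\<^sup>2 / 2 * (1 / (1 - c / 3)))"
    using c c0 by (intro sums_mult geometric_sums) auto
  have term_le: "inverse (fact (k + 2)) * x ^ (k + 2) \<le> x\<^sup>2 / 2 * (c / 3) ^ k" for k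
  proof -
    have "inverse (fact (k + 2)) * x ^ (k + 2) \<le> \<bar>x ^ (k + 2)\<bar> / fact (k + 2)"
      by (simp add: divide_simps)
    also have "\<dots> \<le> \<bar>x ^ (k + 2)\<bar> / (2 * 3 ^ k)"
      by (intro divide_left_mono fact_ge_two_times_three_power) auto
    also have "\<dots> = x\<^sup>2 * \<bar>x\<bar> ^ k / (2 * 3 ^ k)"
      by (simp add: power_add abs_mult power_abs mult.commute power2_eq_square)
    also have "\<dots> \<le> x\<^sup>2 * c ^ k / (2 * 3 ^ k)"
      using x by (intro divide_right_mono mult_left_mono power_mono) auto
    also have "\<dots> = x\<^sup>2 / 2 * (c / 3) ^ k"
      by (simp add: power_divide)
    finally show ?thesis .
  qed
  have "summable (\<lambda>k. inverse (fact (k + 2)) * x ^ (k + 2))"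
    using summable_exp[of x] by (subst summable_iff_shift[where k=2]) simp
  then have "(\<Sum>k. inverse (fact (k + 2)) * x ^ (k + 2)) \<le> (\<Sum>k. x\<^sup>2 / 2 * (c / 3) ^ k)"
    using term_le geo by (intro suminf_le) (auto simp: sums_iff)
  also have "\<dots> = x\<^sup>2 / (2 * (1 - c / 3))"
    using sums_unique[OF geo] by simp
  finally show ?thesis
    using exp_first_two_terms[of x] by simp
qed

text \<open>On integrating the pointwise estimate the linear term vanishes, because the mean is
  zero, and \<open>1 + u \<le> exp u\<close> turns the quadratic term into an exponent.\<close>

lemma (in prob_space) expectation_exp_le_bernstein:
  fixes Y :: "'a \<Rightarrow> real"
  assumes Y[measurable]: "Y \<in> borel_measurable M"
    and bnd: "AE \<omega> in M. \<bar>Y \<omega>\<bar> \<le> b" and mean: "expectation Y = 0"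
    and var: "expectation (\<lambda>\<omega>. (Y \<omega>)\<^sup>2) \<le> v" and l: "0 \<le> l" "l * b < 3"
  shows "expectation (\<lambda>\<omega>. exp (l * Y \<omega>)) \<le> exp (l\<^sup>2 * v / (2 * (1 - l * b / 3)))"
proof -
  have intY: "integrable M Y"
    by (rule integrable_const_bound[where B=b]) (use bnd in auto)
  have "AE \<omega> in M. norm ((Y \<omega>)\<^sup>2) \<le> b\<^sup>2"
    using bnd by eventually_elim (metis abs_ge_zero norm_power power_mono real_norm_def)
  then have intY2: "integrable M (\<lambda>\<omega>. (Y \<omega>)\<^sup>2)"
    by (intro integrable_const_bound[where B="b\<^sup>2"]) auto
  have lY: "AE \<omega> in M. \<bar>l * Y \<omega>\<bar> \<le> l * b"
    using bnd by eventually_elim (use l in \<open>auto simp: abs_mult intro: mult_left_mono\<close>)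
  define D where "D = 2 * (1 - l * b / 3)"
  have "x < 3 \<Longrightarrow> 0 < 2 * (1 - x / 3)" for x :: real by simp
  from this[OF l(2)] have D: "D > 0" by (simp only: D_def)
  have "expectation (\<lambda>\<omega>. exp (l * Y \<omega>)) \<le> expectation (\<lambda>\<omega>. 1 + l * Y \<omega> + l\<^sup>2 / D * (Y \<omega>)\<^sup>2)"
  proof (rule integral_mono_AE)
    show "integrable M (\<lambda>\<omega>. exp (l * Y \<omega>))"
      by (rule integrable_const_bound[where B="exp (l * b)"]) (use lY in auto)
    show "integrable M (\<lambda>\<omega>. 1 + l * Y \<omega> + l\<^sup>2 / D * (Y \<omega>)\<^sup>2)"
      using intY intY2 by simp
    show "AE \<omega> in M. exp (l * Y \<omega>) \<le> 1 + l * Y \<omega> + l\<^sup>2 / D * (Y \<omega>)\<^sup>2"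
      using lY
    proof eventually_elim
      case (elim \<omega>)
      show ?case
        using exp_le_bernstein[OF elim l(2)] by (simp add: D_def power_mult_distrib)
    qed
  qed
  also have "\<dots> = 1 + l\<^sup>2 / D * expectation (\<lambda>\<omega>. (Y \<omega>)\<^sup>2)"
    using intY intY2 mean by (simp add: prob_space)
  also have "\<dots> \<le> 1 + l\<^sup>2 / D * v"
    using var D by (intro add_left_mono mult_left_mono) auto
  also have "\<dots> \<le> exp (l\<^sup>2 / D * v)"
    by (rule exp_ge_add_one_self)
  finally show ?thesis by (simp add: D_def)
qed

text \<open>For \<open>v = 0\<close> the optimal choice \<open>l = s / (v + b * s / 3)\<close> violates \<open>l * b < 3\<close>.\<close>

lemma bernstein_exponent:
  fixes v b s :: real
  assumes v: "0 \<le> v" and b: "0 < b" and s: "0 < s"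
  obtains l where "0 < l" "l * b < 3"
    "l\<^sup>2 * v / (2 * (1 - l * b / 3)) - l * s \<le> - (s\<^sup>2 / (2 * (v + b * s / 3)))"
proof (cases "v = 0")
  case True
  \<comment> \<open>For \<open>v = 0\<close> the goal amounts to
    \<open>l * s \<ge> 3 * s / (2 * b)\<close>. The witness \<open>3 / (2 * b)\<close> gives
    equality, and \<open>l * b = 3 / 2\<close>.\<close>
  show thesis
    by (rule that[of "3 / (2 * b)"]) (use True b s in \<open>auto simp: field_simps power2_eq_square\<close>)
next
  case False
  define w where "w = v + b * s / 3"
  have w: "w > 0" "v > 0" using False v b s by (auto simp: w_def add_pos_pos)
  \<comment> \<open>The witness is \<open>l = s / w\<close>, the choice that turns the factor
    \<open>1 - l * b / 3\<close> into \<open>v / w\<close>; the two terms of the exponent become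
    \<open>s\<^sup>2 / (2 * w)\<close> and \<open>s\<^sup>2 / w\<close>.\<close>
  have eq: "1 - s / w * b / 3 = v / w"
  proof -
    have "1 - s / w * b / 3 = (w - b * s / 3) / w" using w by (simp add: field_simps)
    then show ?thesis by (simp add: w_def)
  qed
  have "s / w * b < 3"
  proof -
    have "0 < 1 - s / w * b / 3" using w unfolding eq by simp
    moreover have "0 < 1 - x / 3 \<Longrightarrow> x < 3" for x :: real by simp
    ultimately show ?thesis by blast
  qed
  moreover have "(s / w)\<^sup>2 * v / (2 * (1 - s / w * b / 3)) - s / w * s = - (s\<^sup>2 / (2 * w))"
    unfolding eq using w by (simp add: field_simps power2_eq_square)
  ultimately show thesis
    using that[of "s / w"] s w by (simp add: w_def)
qed

section \<open>Half-nets of the unit ball by volume comparison\<close>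

lemma card_separated_le:
  fixes N :: "'a::euclidean_space set"
  assumes fin: "finite N" and N: "N \<subseteq> cball 0 1"
    and sep: "\<And>x y. x \<in> N \<Longrightarrow> y \<in> N \<Longrightarrow> x \<noteq> y \<Longrightarrow> 1 / 2 \<le> dist x y"
  shows "card N \<le> 5 ^ DIM('a)"
proof -
  let ?v = "unit_ball_vol DIM('a)"
  \<comment> \<open>Volume comparison: the balls of radius 1/4 around the points are disjoint and
    all lie in the ball of radius 5/4, whose volume is \<open>5 ^ DIM('a)\<close> times that of each
    of them.\<close>
  have "disjoint_family_on (\<lambda>x. ball x (1 / 4)) N"
    unfolding disjoint_family_on_def
  proof (intro ballI impI)
    fix x y assume "x \<in> N" "y \<in> N" "x \<noteq> y"
    then have "1 / 2 \<le> dist x y" by (rule sep)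
    then show "ball x (1 / 4) \<inter> ball y (1 / 4) = {}"
      by (intro disjoint_ballI) simp
  qed
  then have "measure lborel (\<Union>x\<in>N. ball x (1 / 4)) = (\<Sum>x\<in>N. measure lborel (ball x (1 / 4)))"
    using fin by (intro measure_finite_Union) (auto simp: emeasure_ball)
  also have "\<dots> = card N * (?v * (1 / 4) ^ DIM('a))"
    by (simp add: content_ball)
  finally have "card N * (?v * (1 / 4) ^ DIM('a)) = measure lborel (\<Union>x\<in>N. ball x (1 / 4))" ..
  also have "\<dots> \<le> measure lborel (ball (0::'a) (5 / 4))"
  proof (rule measure_mono_fmeasurable)
    show "(\<Union>x\<in>N. ball x (1 / 4)) \<subseteq> ball (0::'a) (5 / 4)"
    proof
      fix y assume "y \<in> (\<Union>x\<in>N. ball x (1 / 4))"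
      then obtain x where x: "x \<in> N" "dist x y < 1 / 4" by auto
      moreover have "dist 0 x \<le> 1" using x N by auto
      ultimately show "y \<in> ball 0 (5 / 4)"
        using dist_triangle[of 0 y x] by auto
    qed
    show "ball (0::'a) (5 / 4) \<in> fmeasurable lborel"
      by (rule fmeasurableI) (auto simp: emeasure_ball)
    show "(\<Union>x\<in>N. ball x (1 / 4)) \<in> sets lborel"
      by (simp add: borel_open open_UN)
  qed
  also have "\<dots> = 5 ^ DIM('a) * (?v * (1 / 4) ^ DIM('a))"
    by (simp add: content_ball power_divide)
  finally have "real (card N) \<le> 5 ^ DIM('a)"
    by simp
  then have "real (card N) \<le> real (5 ^ DIM('a))" by simp
  then show ?thesis by (simp only: of_nat_le_iff)
qed

text \<open>A 1/2-separated subset of the unit ball of maximal cardinality leaves no point of the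
  ball at distance 1/2 or more from it, since such a point could be added. The direction of
  \<open>y\<close> is thus within 1/2 of some \<open>q\<close>, which costs at most half of the norm
  in the inner product.\<close>

lemma obtain_half_net:
  obtains N :: "'a::euclidean_space set" where "finite N" "N \<subseteq> cball 0 1" "card N \<le> 5 ^ DIM('a)"
    "\<And>y. \<exists>q\<in>N. norm y / 2 \<le> q \<bullet> y"
proof -
  define sepd where "sepd N \<longleftrightarrow> finite N \<and> N \<subseteq> cball (0::'a) 1 \<and>
    (\<forall>x\<in>N. \<forall>y\<in>N. x \<noteq> y \<longrightarrow> 1 / 2 \<le> dist x y)" for N
  have bound: "card N \<le> 5 ^ DIM('a)" if "sepd N" for N
    using that unfolding sepd_def by (intro card_separated_le) blast+
  define c where "c = Max (card ` Collect sepd)"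
  \<comment> \<open>The volume bound leaves only finitely many cardinalities, so a maximum
    exists.\<close>
  have fin: "finite (card ` Collect sepd)"
    by (rule finite_subset[of _ "{..5 ^ DIM('a)}"]) (use bound in auto)
  have "sepd {}" by (simp add: sepd_def)
  then have "c \<in> card ` Collect sepd"
    unfolding c_def using fin by (intro Max_in) auto
  then obtain N where N: "sepd N" "card N = c" by auto
  have near: "\<exists>q\<in>N. dist p q < 1 / 2" if p: "norm p \<le> 1" for p
  proof (rule ccontr)
    assume "\<not> ?thesis"
    then have far: "\<And>q. q \<in> N \<Longrightarrow> 1 / 2 \<le> dist p q" by force
    then have "p \<notin> N" by force
    moreover have "sepd (insert p N)"
      using N(1) far p unfolding sepd_def by (auto simp: dist_commute)
    then have "card (insert p N) \<le> c"
      unfolding c_def using fin by (intro Max_ge) auto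
    ultimately show False using N by (simp add: sepd_def)
  qed
  have "\<exists>q\<in>N. norm y / 2 \<le> q \<bullet> y" for y
  proof (cases "y = 0")
    case True
    then show ?thesis using near[of 0] by auto
  next
    case False
    define p where "p = y /\<^sub>R norm y"
    have p: "norm p = 1" "p \<bullet> y = norm y"
      using False by (auto simp: p_def norm_eq_sqrt_inner real_div_sqrt divide_inverse[symmetric] mult.commute)
    obtain q where q: "q \<in> N" "dist p q < 1 / 2" using near[of p] p by auto
    have "(p - q) \<bullet> y \<le> norm (p - q) * norm y" by (rule norm_cauchy_schwarz)
    also have "\<dots> \<le> 1 / 2 * norm y"
      using q by (intro mult_right_mono) (auto simp: dist_norm)
    finally show ?thesis using q p by (intro bexI[of _ q]) (auto simp: inner_diff_left)
  qed
  then show thesis using that[of N] N bound by (auto simp: sepd_def)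
qed

section \<open>Lipschitz estimates for exponentials, infima and suprema\<close>

lemma abs_exp_diff_le:
  fixes a b R :: real
  assumes "a \<le> R" "b \<le> R"
  shows "\<bar>exp a - exp b\<bar> \<le> exp R * \<bar>a - b\<bar>"
proof -
  have *: "exp a - exp b \<le> exp R * \<bar>a - b\<bar>" if "a \<le> R" for a b :: real
  proof -
    \<comment> \<open>The tangent inequality \<open>1 + u \<le> exp u\<close> at
      \<open>u = b - a\<close> bounds the bracket.\<close>
    have "exp a - exp b = exp a * (1 - exp (b - a))" by (simp add: algebra_simps flip: exp_add)
    also have "\<dots> \<le> exp a * \<bar>a - b\<bar>"
      by (intro mult_left_mono, use exp_ge_add_one_self[of "b - a"] in linarith) simp
    also have "\<dots> \<le> exp R * \<bar>a - b\<bar>"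
      using that by (intro mult_right_mono) auto
    finally show ?thesis .
  qed
  show ?thesis using *[of a b] *[of b a] assms by (auto simp: abs_if split: if_splits)
qed

text \<open>A Lipschitz bound common to a family survives the infimum. This serves
  \<open>potential\<close>; the version for suprema serves \<open>extension\<close>.\<close>

lemma abs_cINF_diff_le:
  fixes f g :: "'b \<Rightarrow> real"
  assumes ne: "T \<noteq> {}" and bd: "bdd_below (f ` T)" "bdd_below (g ` T)"
    and le: "\<And>a. a \<in> T \<Longrightarrow> \<bar>f a - g a\<bar> \<le> d"
  shows "\<bar>(INF a\<in>T. f a) - (INF a\<in>T. g a)\<bar> \<le> d"
proof -
  have "(INF a\<in>T. f a) - d \<le> (INF a\<in>T. g a)"
    using ne by (rule cINF_greatest) (use cINF_lower[OF bd(1)] le in force)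
  moreover have "(INF a\<in>T. g a) - d \<le> (INF a\<in>T. f a)"
    using ne by (rule cINF_greatest) (use cINF_lower[OF bd(2)] le in force)
  ultimately show ?thesis by linarith
qed

lemma abs_cSUP_diff_le:
  fixes f g :: "'b \<Rightarrow> real"
  assumes ne: "T \<noteq> {}" and bd: "bdd_above (f ` T)" "bdd_above (g ` T)"
    and le: "\<And>a. a \<in> T \<Longrightarrow> \<bar>f a - g a\<bar> \<le> d"
  shows "\<bar>(SUP a\<in>T. f a) - (SUP a\<in>T. g a)\<bar> \<le> d"
proof -
  have "(SUP a\<in>T. f a) \<le> (SUP a\<in>T. g a) + d"
    using ne by (rule cSUP_least) (use cSUP_upper[OF _ bd(2)] le in force)
  moreover have "(SUP a\<in>T. g a) \<le> (SUP a\<in>T. f a) + d"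
    using ne by (rule cSUP_least) (use cSUP_upper[OF _ bd(1)] le in force)
  ultimately show ?thesis by linarith
qed

section \<open>The spaces of integrable functions\<close>

text \<open>The Euclidean norm of a finite family is at most the sum of its entries in absolute
  value; with the sum, errors can be added coordinate by coordinate.\<close>

lemma cb_Lip_prefixE:
  assumes "\<psi> \<in> cb_Lip_prefix k"
  obtains B L where "0 \<le> L" "\<And>x. \<bar>\<psi> x\<bar> \<le> B"
    "\<And>x y. \<bar>\<psi> x - \<psi> y\<bar> \<le> L * (\<Sum>j=1..k. norm (x j - y j))"
proof -
  obtain L where L: "\<And>x y. \<bar>\<psi> x - \<psi> y\<bar> \<le> L * L2_set (\<lambda>j. norm (x j - y j)) {1..k}"
    using assms by (auto simp: cb_Lip_prefix_def)
  have "\<bar>\<psi> x - \<psi> y\<bar> \<le> \<bar>L\<bar> * (\<Sum>j=1..k. norm (x j - y j))" for x y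
    using L by (rule order_trans) (intro mult_mono L2_set_le_sum, auto intro: L2_set_nonneg)
  moreover obtain B where "\<And>x. \<bar>\<psi> x\<bar> \<le> B"
    using assms by (auto simp: cb_Lip_prefix_def bounded_iff)
  ultimately show thesis by (intro that[of "\<bar>L\<bar>" B]) auto
qed

text \<open>Each summand is at most the Euclidean norm of the whole family, so returning from the
  sum to that norm costs a factor \<open>k\<close>.\<close>

lemma cb_Lip_prefixI:
  fixes \<psi> :: "(nat \<Rightarrow> real^'d) \<Rightarrow> real"
  assumes L: "0 \<le> L" and B: "\<And>x. \<bar>\<psi> x\<bar> \<le> B"
    and lip: "\<And>x y. \<bar>\<psi> x - \<psi> y\<bar> \<le> L * (\<Sum>j=1..k. norm (x j - y j))"
  shows "\<psi> \<in> cb_Lip_prefix k"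
proof -
  have "\<bar>\<psi> x - \<psi> y\<bar> \<le> (L * k) * L2_set (\<lambda>j. norm (x j - y j)) {1..k}" for x y
  proof -
    have "(\<Sum>j=1..k. norm (x j - y j)) \<le> (\<Sum>j=1..k. L2_set (\<lambda>j. norm (x j - y j)) {1..k})"
      by (intro sum_mono member_le_L2_set) auto
    then have "L * (\<Sum>j=1..k. norm (x j - y j)) \<le> L * (k * L2_set (\<lambda>j. norm (x j - y j)) {1..k})"
      using L by (intro mult_left_mono) auto
    then show ?thesis using lip[of x y] by simp
  qed
  moreover have "bounded (range \<psi>)"
    using B by (auto simp: bounded_iff)
  ultimately show ?thesis by (auto simp: cb_Lip_prefix_def)
qed

lemma cb_LipI:
  fixes f :: "'a::metric_space \<Rightarrow> real"
  assumes "0 \<le> L" "\<And>x. \<bar>f x\<bar> \<le> B" "\<And>x y. \<bar>f x - f y\<bar> \<le> L * dist x y"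
  shows "f \<in> cb_Lip"
proof -
  have "L-lipschitz_on UNIV f"
    using assms by (intro lipschitz_onI) (simp_all add: dist_real_def)
  moreover have "bounded (range f)"
    using assms(2) by (intro boundedI[of _ B]) auto
  ultimately show ?thesis unfolding cb_Lip_def by blast
qed

lemma cb_LipE:
  fixes f :: "'a::metric_space \<Rightarrow> real"
  assumes "f \<in> cb_Lip"
  obtains B L where "0 \<le> L" "\<And>x. \<bar>f x\<bar> \<le> B" "\<And>x y. \<bar>f x - f y\<bar> \<le> L * dist x y"
proof -
  obtain L where L: "L-lipschitz_on UNIV f" and b: "bounded (range f)"
    using assms unfolding cb_Lip_def by blast
  obtain B where "\<And>x. \<bar>f x\<bar> \<le> B"
    using b unfolding bounded_iff by auto
  moreover have "\<bar>f x - f y\<bar> \<le> L * dist x y" for x y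
    using lipschitz_onD[OF L, of x y] by (simp add: dist_real_def)
  ultimately show thesis
    using that lipschitz_on_nonneg[OF L] by blast
qed

text \<open>The topology is the product topology: the Lipschitz bound involves finitely many
  coordinates, each of them continuous. This is what makes compositions with \<open>\<psi>\<close>
  Borel measurable.\<close>

lemma cb_Lip_prefix_continuous:
  fixes \<psi> :: "(nat \<Rightarrow> real^'d) \<Rightarrow> real"
  assumes "\<psi> \<in> cb_Lip_prefix k"
  shows "continuous_on UNIV \<psi>"
proof -
  obtain B L where L: "0 \<le> L" "\<And>x y. \<bar>\<psi> x - \<psi> y\<bar> \<le> L * (\<Sum>j=1..k. norm (x j - y j))"
    using cb_Lip_prefixE[OF assms] by metis
  have "(\<psi> \<longlongrightarrow> \<psi> x) (at x)" for x
  proof (rule Lim_null[THEN iffD2], rule Lim_null_comparison)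
    show "eventually (\<lambda>y. norm (\<psi> y - \<psi> x) \<le> L * (\<Sum>j=1..k. norm (y j - x j))) (at x)"
      using L by simp
    have "isCont (\<lambda>y. y j) x" for j
      using continuous_on_product_coordinates[where i=j]
      by (metis UNIV_I continuous_on_eq_continuous_at open_UNIV)
    then have "isCont (\<lambda>y. L * (\<Sum>j=1..k. norm (y j - x j))) x"
      by (intro continuous_intros) auto
    then show "((\<lambda>y. L * (\<Sum>j=1..k. norm (y j - x j))) \<longlongrightarrow> 0) (at x)"
      by (auto dest: isContD)
  qed
  then show ?thesis by (simp add: continuous_on_def)
qed

lemma Lp_space_vec_measurable:
  fixes Y :: "'a::metric_space \<Rightarrow> real^'d"
  assumes "Y \<in> Lp_space_vec \<P> p"
  shows "Y \<in> borel_measurable borel"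
proof -
  have "(\<lambda>\<omega>. Y \<omega> $ i) \<in> borel_measurable borel" for i
    using assms by (simp add: Lp_space_vec_def Lp_space_def)
  then show ?thesis
    by (subst borel_measurable_euclidean_space) (auto simp: Basis_vec_def inner_axis)
qed

section \<open>Upper moments and the extended expectation\<close>

locale represented_expectation =
  fixes \<P> :: "'a::metric_space measure set" and E :: "('a \<Rightarrow> real) \<Rightarrow> real"
  assumes rep: "represents \<P> E" and sub: "sublinear_expectation E"
begin

lemma measures_nonempty: "\<P> \<noteq> {}"
proof
  assume "\<P> = {}"
  then have "E (\<lambda>_. c) = Sup {}" for c
    using rep by (auto simp: represents_def intro!: cb_LipI[of 0 _ "\<bar>c\<bar>"])
  then have "E (\<lambda>_. 0) = E (\<lambda>_. 1)" by simp
  with sub show False by (simp add: sublinear_expectation_def)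
qed

lemma measures_prob_space: "P \<in> \<P> \<Longrightarrow> prob_space P"
  and sets_measures: "P \<in> \<P> \<Longrightarrow> sets P = sets borel"
  using rep by (auto simp: represents_def space_prob_algebra)

lemma measures_measurable:
  fixes f :: "'a \<Rightarrow> 'b::topological_space"
  shows "P \<in> \<P> \<Longrightarrow> f \<in> borel_measurable borel \<Longrightarrow> f \<in> borel_measurable P"
  using measurable_cong_sets[OF sets_measures refl] by blast

text \<open>\<open>upper_moment\<close> sees functions only up to null sets of every
  \<open>P \<in> \<P>\<close>, so the approximating sequence of \<open>f\<close> also serves
  \<open>g\<close>.\<close>

lemma Lp_space_cong_AE:
  assumes f: "f \<in> Lp_space \<P> p" and g: "g \<in> borel_measurable borel"
    and eq: "\<And>P. P \<in> \<P> \<Longrightarrow> AE \<omega> in P. f \<omega> = g \<omega>"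
  shows "g \<in> Lp_space \<P> p"
proof -
  obtain S where S: "Lp_approx \<P> p S f" using f by (auto simp: Lp_space_def)
  have "upper_moment \<P> p (\<lambda>\<omega>. S k \<omega> - g \<omega>) = upper_moment \<P> p (\<lambda>\<omega>. S k \<omega> - f \<omega>)" for k
    unfolding upper_moment_def
    by (intro SUP_cong refl nn_integral_cong_AE) (use eq in \<open>force elim: eventually_mono\<close>)
  then have "Lp_approx \<P> p S g" using S by (simp add: Lp_approx_def)
  then show ?thesis using g by (auto simp: Lp_space_def)
qed

lemma upper_moment_1_le:
  assumes f: "f \<in> borel_measurable borel" and e: "e > 0"
  shows "upper_moment \<P> 1 f \<le> ennreal e + ennreal (1 / e) * upper_moment \<P> 2 f"
  unfolding upper_moment_def
proof (rule SUP_least)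
  fix P assume P: "P \<in> \<P>"
  interpret prob_space P using P by (rule measures_prob_space)
  have [measurable]: "f \<in> borel_measurable P" using P f by (rule measures_measurable)
  have le: "ennreal (\<bar>f \<omega>\<bar> powr 1) \<le> ennreal e + ennreal (1 / e) * ennreal (\<bar>f \<omega>\<bar> powr 2)" for \<omega>
  proof -
    \<comment> \<open>The pointwise bound of the absolute value by
      \<open>e + 1 / e * (f \<omega>)\<^sup>2\<close>, with \<open>e\<close> free, takes the place
      of the Cauchy-Schwarz inequality and avoids square roots of upper moments.\<close>
    have "0 \<le> (\<bar>f \<omega>\<bar> - e)\<^sup>2 + e * \<bar>f \<omega>\<bar>" using e by simp
    then have "e * \<bar>f \<omega>\<bar> \<le> e * e + (f \<omega>)\<^sup>2" by (simp add: power2_eq_square algebra_simps)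
    then have "\<bar>f \<omega>\<bar> \<le> e + 1 / e * (f \<omega>)\<^sup>2" using e by (simp add: field_simps)
    moreover have "\<bar>f \<omega>\<bar> powr 2 = (f \<omega>)\<^sup>2" by simp
    ultimately have "ennreal \<bar>f \<omega>\<bar> \<le> ennreal (e + 1 / e * \<bar>f \<omega>\<bar> powr 2)"
      by (simp add: ennreal_leI)
    then show ?thesis using e by (simp flip: ennreal_mult'')
  qed
  have "(\<integral>\<^sup>+\<omega>. ennreal (\<bar>f \<omega>\<bar> powr 1) \<partial>P)
      \<le> (\<integral>\<^sup>+\<omega>. ennreal e + ennreal (1 / e) * ennreal (\<bar>f \<omega>\<bar> powr 2) \<partial>P)"
    by (intro nn_integral_mono le)
  also have "\<dots> = ennreal e + ennreal (1 / e) * (\<integral>\<^sup>+\<omega>. ennreal (\<bar>f \<omega>\<bar> powr 2) \<partial>P)"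
    by (simp add: nn_integral_add nn_integral_cmult emeasure_space_1)
  also have "\<dots> \<le> ennreal e + ennreal (1 / e) * (SUP P\<in>\<P>. \<integral>\<^sup>+\<omega>. ennreal (\<bar>f \<omega>\<bar> powr 2) \<partial>P)"
    using P by (intro add_left_mono mult_left_mono SUP_upper) auto
  finally show "(\<integral>\<^sup>+\<omega>. ennreal (\<bar>f \<omega>\<bar> powr 1) \<partial>P) \<le> \<dots>" .
qed

lemma Lp_approx_2_imp_1:
  assumes X: "X \<in> borel_measurable borel" and S: "Lp_approx \<P> 2 S X"
  shows "Lp_approx \<P> 1 S X"
  unfolding Lp_approx_def
proof (intro conjI allI)
  let ?m = "\<lambda>p k. upper_moment \<P> p (\<lambda>\<omega>. S k \<omega> - X \<omega>)"
  have S2: "S k \<in> cb_Lip" "?m 2 \<longlonglongrightarrow> 0" for k using S by (auto simp: Lp_approx_def)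
  show "S k \<in> cb_Lip" for k by (rule S2)
  show "?m 1 \<longlonglongrightarrow> 0"
  proof (rule tendsto_zero_ennreal)
    fix r :: real assume r: "0 < r"
    \<comment> \<open>With \<open>e = r / 2\<close> the bound on the first moment tends to
      \<open>r / 2\<close>, which is below \<open>r\<close>.\<close>
    have "(\<lambda>k. ennreal (r / 2) + ennreal (1 / (r / 2)) * ?m 2 k) \<longlonglongrightarrow> ennreal (r / 2) + ennreal (1 / (r / 2)) * 0"
      by (intro tendsto_add tendsto_const ennreal_tendsto_cmult S2) auto
    then have "eventually (\<lambda>k. ennreal (r / 2) + ennreal (1 / (r / 2)) * ?m 2 k < ennreal r) sequentially"
      by (rule order_tendstoD) (use r in \<open>simp add: ennreal_lessI\<close>)
    then show "eventually (\<lambda>k. ?m 1 k < ennreal r) sequentially"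
    proof eventually_elim
      case (elim k)
      have "(\<lambda>\<omega>. S k \<omega> - X \<omega>) \<in> borel_measurable borel"
        using X cb_Lip_measurable[OF S2(1)] by measurable
      from upper_moment_1_le[OF this, of "r / 2"] r elim show ?case by (auto intro: le_less_trans)
    qed
  qed
qed

text \<open>Replacing every coordinate of the vectors by an approximating bounded Lipschitz function
  turns the composition into an element of \<open>cb_Lip\<close>. The error in the first upper
  moment is at most \<open>L\<close> times the sum of the coordinatewise errors.\<close>

lemma cb_Lip_prefix_comp_Lp_space:
  fixes X :: "nat \<Rightarrow> 'a \<Rightarrow> real^'d"
  assumes \<psi>: "\<psi> \<in> cb_Lip_prefix k" and X: "\<And>j. j \<in> {1..k} \<Longrightarrow> X j \<in> Lp_space_vec \<P> 2"
  shows "(\<lambda>\<omega>. \<psi> (\<lambda>j. X j \<omega>)) \<in> Lp_space \<P> 1"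
proof -
  obtain B L where L: "0 \<le> L" and B: "\<And>x. \<bar>\<psi> x\<bar> \<le> B"
    and lip: "\<And>x y. \<bar>\<psi> x - \<psi> y\<bar> \<le> L * (\<Sum>j=1..k. norm (x j - y j))"
    using cb_Lip_prefixE[OF \<psi>] by metis
  have lip1: "\<bar>\<psi> x - \<psi> y\<bar> \<le> L * (\<Sum>j=1..k. \<Sum>c\<in>UNIV. \<bar>x j $ c - y j $ c\<bar>)" for x y
    using lip by (rule order_trans)
      (use L in \<open>intro mult_left_mono sum_mono norm_le_l1_cart[THEN order_trans], auto\<close>)
  have Xm: "X j \<in> borel_measurable borel" if "j \<in> {1..k}" for j
    using X[OF that] by (rule Lp_space_vec_measurable)
  have "\<exists>S. Lp_approx \<P> 1 S (\<lambda>\<omega>. X j \<omega> $ c)" if "j \<in> {1..k}" for j c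
  proof -
    have "(\<lambda>\<omega>. X j \<omega> $ c) \<in> Lp_space \<P> 2"
      using X[OF that] by (simp add: Lp_space_vec_def)
    then show ?thesis by (auto simp: Lp_space_def dest: Lp_approx_2_imp_1)
  qed
  then have "\<exists>S. \<forall>j c. j \<in> {1..k} \<longrightarrow> Lp_approx \<P> 1 (S j c) (\<lambda>\<omega>. X j \<omega> $ c)"
    by (intro choice allI) blast
  then obtain S where S: "\<And>j c. j \<in> {1..k} \<Longrightarrow> Lp_approx \<P> 1 (S j c) (\<lambda>\<omega>. X j \<omega> $ c)"
    by blast
  define Z where "Z m j \<omega> = (\<chi> c. S j c m \<omega>)" for m j \<omega>
  have prefix_cong: "\<psi> x = \<psi> y" if "\<And>j. j \<in> {1..k} \<Longrightarrow> x j = y j" for x y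
    using lip[of x y] that by simp
  have meas: "(\<lambda>\<omega>. \<psi> (\<lambda>j. X j \<omega>)) \<in> borel_measurable borel"
  proof -
    \<comment> \<open>Nothing is known about the vectors with index outside \<open>{1..k}\<close>.
      They are replaced by 0, which \<open>\<psi>\<close> cannot notice.\<close>
    have "(\<lambda>\<omega> j. if j \<in> {1..k} then X j \<omega> else 0) \<in> borel_measurable borel"
    proof (rule measurable_coordinatewise_then_product)
      show "(\<lambda>\<omega>. if i \<in> {1..k} then X i \<omega> else 0) \<in> borel_measurable borel" for i
        by (cases "i \<in> {1..k}", use Xm[of i] in simp, simp only: if_False, rule borel_measurable_const)
    qed
    from borel_measurable_continuous_on[OF cb_Lip_prefix_continuous[OF \<psi>] this]
    have "(\<lambda>\<omega>. \<psi> (\<lambda>j. if j \<in> {1..k} then X j \<omega> else 0)) \<in> borel_measurable borel" .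
    moreover have "\<psi> (\<lambda>j. if j \<in> {1..k} then X j \<omega> else 0) = \<psi> (\<lambda>j. X j \<omega>)" for \<omega>
      by (rule prefix_cong) simp
    ultimately show ?thesis by simp
  qed
  have ZL: "(\<lambda>\<omega>. \<psi> (\<lambda>j. Z m j \<omega>)) \<in> cb_Lip" for m
  proof -
    have "\<forall>j\<in>{1..k}. \<forall>c. \<exists>K\<ge>0. \<forall>x y. \<bar>S j c m x - S j c m y\<bar> \<le> K * dist x y"
      using S by (metis Lp_approx_def cb_LipE)
    then obtain K where K: "\<And>j c. j \<in> {1..k} \<Longrightarrow> 0 \<le> K j c"
      "\<And>j c x y. j \<in> {1..k} \<Longrightarrow> \<bar>S j c m x - S j c m y\<bar> \<le> K j c * dist x y"
      by metis
    show ?thesis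
    proof (rule cb_LipI)
      show "0 \<le> L * (\<Sum>j=1..k. \<Sum>c\<in>UNIV. K j c)"
        using L K by (intro mult_nonneg_nonneg sum_nonneg) auto
      show "\<bar>\<psi> (\<lambda>j. Z m j \<omega>)\<bar> \<le> B" for \<omega> by (rule B)
      fix x y
      have "\<bar>\<psi> (\<lambda>j. Z m j x) - \<psi> (\<lambda>j. Z m j y)\<bar> \<le> L * (\<Sum>j=1..k. \<Sum>c\<in>UNIV. \<bar>Z m j x $ c - Z m j y $ c\<bar>)"
        by (rule lip1)
      also have "\<dots> \<le> L * (\<Sum>j=1..k. \<Sum>c\<in>UNIV. K j c * dist x y)"
        using L K by (intro mult_left_mono sum_mono) (auto simp: Z_def)
      finally show "\<bar>\<psi> (\<lambda>j. Z m j x) - \<psi> (\<lambda>j. Z m j y)\<bar> \<le> L * (\<Sum>j=1..k. \<Sum>c\<in>UNIV. K j c) * dist x y"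
        by (simp add: sum_distrib_right mult.assoc)
    qed
  qed
  let ?u = "\<lambda>m. upper_moment \<P> 1 (\<lambda>\<omega>. \<psi> (\<lambda>j. Z m j \<omega>) - \<psi> (\<lambda>j. X j \<omega>))"
  let ?v = "\<lambda>j c m. upper_moment \<P> 1 (\<lambda>\<omega>. S j c m \<omega> - X j \<omega> $ c)"
  have le: "?u m \<le> ennreal L * (\<Sum>j=1..k. \<Sum>c\<in>UNIV. ?v j c m)" for m
    unfolding upper_moment_def[of \<P> 1 "\<lambda>\<omega>. \<psi> (\<lambda>j. Z m j \<omega>) - \<psi> (\<lambda>j. X j \<omega>)"]
  proof (rule SUP_least)
    fix P assume P: "P \<in> \<P>"
    have [measurable]: "(\<lambda>\<omega>. S j c m \<omega> - X j \<omega> $ c) \<in> borel_measurable P" if "j \<in> {1..k}" for j c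
    proof (rule measures_measurable[OF P])
      have "S j c m \<in> borel_measurable borel" using S[OF that] by (auto simp: Lp_approx_def intro: cb_Lip_measurable)
      moreover have "(\<lambda>\<omega>. X j \<omega> $ c) \<in> borel_measurable borel"
        using X[OF that] by (auto simp: Lp_space_vec_def Lp_space_def)
      ultimately show "(\<lambda>\<omega>. S j c m \<omega> - X j \<omega> $ c) \<in> borel_measurable borel" by measurable
    qed
    have "(\<integral>\<^sup>+\<omega>. ennreal (\<bar>\<psi> (\<lambda>j. Z m j \<omega>) - \<psi> (\<lambda>j. X j \<omega>)\<bar> powr 1) \<partial>P)
      \<le> (\<integral>\<^sup>+\<omega>. ennreal L * (\<Sum>j=1..k. \<Sum>c\<in>UNIV. ennreal \<bar>S j c m \<omega> - X j \<omega> $ c\<bar>) \<partial>P)"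
    proof (rule nn_integral_mono)
      fix \<omega>
      have "\<bar>\<psi> (\<lambda>j. Z m j \<omega>) - \<psi> (\<lambda>j. X j \<omega>)\<bar> \<le> L * (\<Sum>j=1..k. \<Sum>c\<in>UNIV. \<bar>Z m j \<omega> $ c - X j \<omega> $ c\<bar>)"
        by (rule lip1)
      then show "ennreal (\<bar>\<psi> (\<lambda>j. Z m j \<omega>) - \<psi> (\<lambda>j. X j \<omega>)\<bar> powr 1)
        \<le> ennreal L * (\<Sum>j=1..k. \<Sum>c\<in>UNIV. ennreal \<bar>S j c m \<omega> - X j \<omega> $ c\<bar>)"
        using L by (simp add: Z_def sum_ennreal sum_nonneg ennreal_leI flip: ennreal_mult')
    qed
    also have "\<dots> = ennreal L * (\<Sum>j=1..k. \<Sum>c\<in>UNIV. \<integral>\<^sup>+\<omega>. ennreal \<bar>S j c m \<omega> - X j \<omega> $ c\<bar> \<partial>P)"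
      by (subst nn_integral_cmult, measurable, subst nn_integral_sum, measurable,
          intro arg_cong[where f="\<lambda>x. ennreal L * x"] sum.cong refl nn_integral_sum, measurable)
    also have "\<dots> \<le> ennreal L * (\<Sum>j=1..k. \<Sum>c\<in>UNIV. ?v j c m)"
      unfolding upper_moment_def
      using P by (intro mult_left_mono sum_mono SUP_upper2[OF P]) auto
    finally show "(\<integral>\<^sup>+\<omega>. ennreal (\<bar>\<psi> (\<lambda>j. Z m j \<omega>) - \<psi> (\<lambda>j. X j \<omega>)\<bar> powr 1) \<partial>P) \<le> \<dots>" .
  qed
  have "(\<lambda>m. ennreal L * (\<Sum>j=1..k. \<Sum>c\<in>UNIV. ?v j c m)) \<longlonglongrightarrow> ennreal L * (\<Sum>j=1..k. \<Sum>c\<in>(UNIV::'d set). 0)"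
    using S by (intro ennreal_tendsto_cmult tendsto_sum) (auto simp: Lp_approx_def)
  then have "(\<lambda>m. ennreal L * (\<Sum>j=1..k. \<Sum>c\<in>UNIV. ?v j c m)) \<longlonglongrightarrow> 0" by simp
  then have "?u \<longlonglongrightarrow> 0"
    by (rule tendsto_sandwich[OF _ _ tendsto_const, rotated 2]) (use le in auto)
  then have "Lp_approx \<P> 1 (\<lambda>m \<omega>. \<psi> (\<lambda>j. Z m j \<omega>)) (\<lambda>\<omega>. \<psi> (\<lambda>j. X j \<omega>))"
    using ZL by (simp add: Lp_approx_def)
  then show ?thesis using meas by (auto simp: Lp_space_def)
qed

lemma cb_Lip_comp_Lp_space:
  fixes Y :: "'a \<Rightarrow> real^'d"
  assumes "\<phi> \<in> cb_Lip" "Y \<in> Lp_space_vec \<P> 2"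
  shows "(\<lambda>\<omega>. \<phi> (Y \<omega>)) \<in> Lp_space \<P> 1"
proof -
  obtain B L where L: "0 \<le> L" "\<And>x. \<bar>\<phi> x\<bar> \<le> B" "\<And>x y. \<bar>\<phi> x - \<phi> y\<bar> \<le> L * dist x y"
    using cb_LipE[OF assms(1)] by metis
  have "(\<lambda>x. \<phi> (x 1)) \<in> cb_Lip_prefix 1"
    by (rule cb_Lip_prefixI[OF L(1,2)]) (use L(3) in \<open>simp add: dist_norm\<close>)
  from cb_Lip_prefix_comp_Lp_space[OF this, of "\<lambda>_. Y"] assms(2) show ?thesis by simp
qed

lemma bounded_integral_le:
  fixes B :: real
  assumes P: "P \<in> \<P>" and f: "f \<in> borel_measurable borel" and B: "AE \<omega> in P. \<bar>f \<omega>\<bar> \<le> B"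
  shows "integrable P f" "\<bar>\<integral>\<omega>. f \<omega> \<partial>P\<bar> \<le> B"
proof -
  interpret prob_space P using P by (rule measures_prob_space)
  have [measurable]: "f \<in> borel_measurable P" using P f by (rule measures_measurable)
  show i: "integrable P f"
    by (rule integrable_const_bound[where B=B]) (use B in auto)
  have "\<bar>\<integral>\<omega>. f \<omega> \<partial>P\<bar> \<le> (\<integral>\<omega>. \<bar>f \<omega>\<bar> \<partial>P)" by (rule integral_abs_bound)
  also have "\<dots> \<le> B" using i B by (intro integral_le_const) auto
  finally show "\<bar>\<integral>\<omega>. f \<omega> \<partial>P\<bar> \<le> B" .
qed

lemma bdd_above_integrals:
  fixes B :: real
  assumes f: "f \<in> borel_measurable borel" and B: "\<And>P. P \<in> \<P> \<Longrightarrow> AE \<omega> in P. \<bar>f \<omega>\<bar> \<le> B"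
  shows "bdd_above ((\<lambda>P. \<integral>\<omega>. f \<omega> \<partial>P) ` \<P>)"
proof (rule bdd_aboveI2)
  show "(\<integral>\<omega>. f \<omega> \<partial>P) \<le> B" if "P \<in> \<P>" for P
    using bounded_integral_le(2)[OF that f B[OF that]] by linarith
qed

text \<open>The bound \<open>B\<close> makes the family of integrals bounded above, so that the real
  supremum dominates each of them.\<close>

lemma integral_le_extension:
  fixes B :: real
  assumes f: "f \<in> Lp_space \<P> 1" and B: "\<And>P. P \<in> \<P> \<Longrightarrow> AE \<omega> in P. \<bar>f \<omega>\<bar> \<le> B" and P: "P \<in> \<P>"
  shows "(\<integral>\<omega>. f \<omega> \<partial>P) \<le> extension \<P> E f"
  unfolding extension_eq_SUP[OF rep sub f]
  using P 
proof (rule cSUP_upper)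
  show "bdd_above ((\<lambda>P. \<integral>\<omega>. f \<omega> \<partial>P) ` \<P>)"
    by (rule bdd_above_integrals[OF _ B]) (use f in \<open>auto simp: Lp_space_def\<close>)
qed

lemma extension_le:
  assumes f: "f \<in> Lp_space \<P> 1" and le: "\<And>P. P \<in> \<P> \<Longrightarrow> (\<integral>\<omega>. f \<omega> \<partial>P) \<le> c"
  shows "extension \<P> E f \<le> c"
  unfolding extension_eq_SUP[OF rep sub f]
  using measures_nonempty le by (rule cSUP_least)

end

section \<open>A single bounded vector\<close>

lemma cb_Lip_prefix_update:
  assumes \<psi>: "\<psi> \<in> cb_Lip_prefix k" and i: "i \<in> {1..k}"
  shows "(\<lambda>y. \<psi> (x(i := y))) \<in> cb_Lip"
proof -
  obtain B L where L: "0 \<le> L" "\<And>x. \<bar>\<psi> x\<bar> \<le> B"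
    "\<And>x y. \<bar>\<psi> x - \<psi> y\<bar> \<le> L * (\<Sum>j=1..k. norm (x j - y j))"
    using cb_Lip_prefixE[OF \<psi>] by metis
  show ?thesis
  proof (rule cb_LipI[OF L(1,2)])
    fix y z
    have "(\<Sum>j=1..k. norm ((x(i := y)) j - (x(i := z)) j)) = (\<Sum>j\<in>{1..k}. if i = j then dist y z else 0)"
      by (intro sum.cong) (auto simp: dist_norm)
    also have "\<dots> = dist y z" using i by simp
    finally show "\<bar>\<psi> (x(i := y)) - \<psi> (x(i := z))\<bar> \<le> L * dist y z"
      using L(3)[of "x(i := y)" "x(i := z)"] by simp
  qed
qed

text \<open>The projection onto a ball around 0. It is bounded, does not increase distances and
  fixes the ball, so it makes functions of a bounded vector bounded and Lipschitz without changing
  them almost surely.\<close>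

definition clip :: "real \<Rightarrow> 'b::euclidean_space \<Rightarrow> 'b" where
  "clip M = closest_point (cball 0 M)"

lemma norm_clip_le: "0 \<le> M \<Longrightarrow> norm (clip M x) \<le> M"
  using closest_point_in_set[of "cball 0 M" x] by (simp add: clip_def)

lemma norm_clip_diff_le: "0 \<le> M \<Longrightarrow> norm (clip M x - clip M y) \<le> norm (x - y)"
  using closest_point_lipschitz[of "cball 0 M" x y] by (simp add: clip_def dist_norm)

lemma clip_eq: "norm x \<le> M \<Longrightarrow> clip M x = x"
  by (simp add: clip_def closest_point_self)

context represented_expectation
begin

text \<open>The bound and the Lipschitz constant of \<open>\<psi>\<close> pass through the integrals
  and the supremum. The inner expectation in the definition of independence is therefore again a
  bounded Lipschitz function of the first \<open>k\<close> vectors, and the outer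
  \<open>extension\<close> can be treated as a supremum.\<close>

lemma extension_update_prefix:
  fixes Y :: "'a \<Rightarrow> real^'d"
  assumes \<psi>: "\<psi> \<in> cb_Lip_prefix (Suc k)" and Y: "Y \<in> Lp_space_vec \<P> 2"
  shows "(\<lambda>x. extension \<P> E (\<lambda>\<omega>. \<psi> (x(Suc k := Y \<omega>)))) \<in> cb_Lip_prefix k"
proof -
  obtain B L where L: "0 \<le> L" and B: "\<And>x. \<bar>\<psi> x\<bar> \<le> B"
    and lip: "\<And>x y. \<bar>\<psi> x - \<psi> y\<bar> \<le> L * (\<Sum>j=1..Suc k. norm (x j - y j))"
    using cb_Lip_prefixE[OF \<psi>] by metis
  have Lp: "(\<lambda>\<omega>. \<psi> (x(Suc k := Y \<omega>))) \<in> Lp_space \<P> 1" for x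
    by (rule cb_Lip_comp_Lp_space[OF cb_Lip_prefix_update[OF \<psi>] Y]) simp
  then have meas: "(\<lambda>\<omega>. \<psi> (x(Suc k := Y \<omega>))) \<in> borel_measurable borel" for x
    by (simp add: Lp_space_def)
  have bd: "bdd_above ((\<lambda>P. \<integral>\<omega>. \<psi> (x(Suc k := Y \<omega>)) \<partial>P) ` \<P>)" for x
    by (rule bdd_above_integrals[OF meas, where B=B]) (simp add: B)
  note ext = extension_eq_SUP[OF rep sub Lp]
  show ?thesis
  proof (rule cb_Lip_prefixI[OF L])
    show "\<bar>extension \<P> E (\<lambda>\<omega>. \<psi> (x(Suc k := Y \<omega>)))\<bar> \<le> B" for x
      unfolding ext
    proof (rule cSup_abs_le)
      fix I assume "I \<in> (\<lambda>P. \<integral>\<omega>. \<psi> (x(Suc k := Y \<omega>)) \<partial>P) ` \<P>"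
      then obtain P where P: "P \<in> \<P>" "I = (\<integral>\<omega>. \<psi> (x(Suc k := Y \<omega>)) \<partial>P)" by blast
      show "\<bar>I\<bar> \<le> B"
        unfolding P(2) by (rule bounded_integral_le(2)[OF P(1) meas]) (simp add: B)
    qed (use measures_nonempty in simp)
    fix x y :: "nat \<Rightarrow> real^'d"
    let ?d = "L * (\<Sum>j=1..k. norm (x j - y j))"
    show "\<bar>extension \<P> E (\<lambda>\<omega>. \<psi> (x(Suc k := Y \<omega>))) - extension \<P> E (\<lambda>\<omega>. \<psi> (y(Suc k := Y \<omega>)))\<bar> \<le> ?d"
      unfolding ext
    proof (rule abs_cSUP_diff_le[OF measures_nonempty bd bd])
      fix P assume P: "P \<in> \<P>"
      have int: "integrable P (\<lambda>\<omega>. \<psi> (x(Suc k := Y \<omega>)))" for x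
        by (rule bounded_integral_le(1)[OF P meas, where B=B]) (simp add: B)
      have "\<bar>\<psi> (x(Suc k := y')) - \<psi> (y(Suc k := y'))\<bar> \<le> ?d" for y'
      proof -
        have "(\<Sum>j=1..Suc k. norm ((x(Suc k := y')) j - (y(Suc k := y')) j)) = (\<Sum>j=1..k. norm (x j - y j))"
          by simp
        then show ?thesis using lip[of "x(Suc k := y')" "y(Suc k := y')"] by simp
      qed
      then have "\<bar>\<integral>\<omega>. \<psi> (x(Suc k := Y \<omega>)) - \<psi> (y(Suc k := Y \<omega>)) \<partial>P\<bar> \<le> ?d"
        by (intro bounded_integral_le(2)[OF P]) (use meas in \<open>auto intro: borel_measurable_diff\<close>)
      then show "\<bar>(\<integral>\<omega>. \<psi> (x(Suc k := Y \<omega>)) \<partial>P) - (\<integral>\<omega>. \<psi> (y(Suc k := Y \<omega>)) \<partial>P)\<bar> \<le> ?d"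
        using int by simp
    qed
  qed
qed

end

section \<open>Means, variances and exponential moments of a bounded vector\<close>

locale bounded_vector = represented_expectation \<P> E
  for \<P> :: "'a::metric_space measure set" and E :: "('a \<Rightarrow> real) \<Rightarrow> real" +
  fixes Y :: "'a \<Rightarrow> real^'d" and M :: real
  assumes Y_Lp: "Y \<in> Lp_space_vec \<P> 2" and M_nonneg: "0 \<le> M"
    and Y_bounded: "\<And>P. P \<in> \<P> \<Longrightarrow> AE \<omega> in P. norm (Y \<omega>) \<le> M"
begin

lemma Y_measurable: "Y \<in> borel_measurable borel"
  using Y_Lp by (rule Lp_space_vec_measurable)

text \<open>Linear and quadratic \<open>h\<close> are in general unbounded. Only their values on the
  ball of radius \<open>M\<close> matter, and there clipping is the identity.\<close>

lemma Lp_space_clip: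
  assumes h: "(\<lambda>x. h (clip M x)) \<in> cb_Lip" and hm: "h \<in> borel_measurable borel"
  shows "(\<lambda>\<omega>. h (Y \<omega>)) \<in> Lp_space \<P> 1"
proof (rule Lp_space_cong_AE[OF cb_Lip_comp_Lp_space[OF h Y_Lp]])
  show "(\<lambda>\<omega>. h (Y \<omega>)) \<in> borel_measurable borel"
    using measurable_compose[OF Y_measurable hm] .
  show "AE \<omega> in P. h (clip M (Y \<omega>)) = h (Y \<omega>)" if "P \<in> \<P>" for P
    using Y_bounded[OF that] by eventually_elim (simp add: clip_eq)
qed

lemma inner_Lp_space: "(\<lambda>\<omega>. p \<bullet> Y \<omega>) \<in> Lp_space \<P> 1"
proof (rule Lp_space_clip)
  show "(\<lambda>x. p \<bullet> clip M x) \<in> cb_Lip"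
  proof (rule cb_LipI)
    show "\<bar>p \<bullet> clip M x\<bar> \<le> norm p * M" for x
      by (rule order_trans[OF Cauchy_Schwarz_ineq2]) (simp add: mult_left_mono norm_clip_le M_nonneg)
    show "\<bar>p \<bullet> clip M x - p \<bullet> clip M y\<bar> \<le> norm p * dist x y" for x y
      unfolding inner_diff_right[symmetric] dist_norm
      by (rule order_trans[OF Cauchy_Schwarz_ineq2]) (simp add: mult_left_mono norm_clip_diff_le M_nonneg)
  qed simp
qed measurable

lemma square_dist_Lp_space: "(\<lambda>\<omega>. (norm (Y \<omega> - \<theta>))\<^sup>2) \<in> Lp_space \<P> 1"
proof (rule Lp_space_clip)
  have le: "norm (clip M x - \<theta>) \<le> M + norm \<theta>" for x
    using norm_triangle_ineq4[of "clip M x" \<theta>] norm_clip_le[OF M_nonneg, of x] by linarith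
  show "(\<lambda>x. (norm (clip M x - \<theta>))\<^sup>2) \<in> cb_Lip"
  proof (rule cb_LipI)
    show "\<bar>(norm (clip M x - \<theta>))\<^sup>2\<bar> \<le> (M + norm \<theta>)\<^sup>2" for x
      using le[of x] by (simp add: power_mono)
    show "0 \<le> 2 * (M + norm \<theta>)" using M_nonneg by simp
    fix x y
    let ?a = "norm (clip M x - \<theta>)" and ?b = "norm (clip M y - \<theta>)"
    have "\<bar>?a\<^sup>2 - ?b\<^sup>2\<bar> = \<bar>?a + ?b\<bar> * \<bar>?a - ?b\<bar>"
      by (simp add: power2_eq_square square_diff_square_factored abs_mult)
    also have "\<dots> \<le> (2 * (M + norm \<theta>)) * dist x y"
    proof (rule mult_mono)
      show "\<bar>?a + ?b\<bar> \<le> 2 * (M + norm \<theta>)" using le[of x] le[of y] by simp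
      have "\<bar>?a - ?b\<bar> \<le> norm (clip M x - clip M y)"
        using norm_triangle_ineq3[of "clip M x - \<theta>" "clip M y - \<theta>"] by simp
      then show "\<bar>?a - ?b\<bar> \<le> dist x y"
        using norm_clip_diff_le[OF M_nonneg, of x y] by (simp add: dist_norm)
    qed (use M_nonneg in auto)
    finally show "\<bar>?a\<^sup>2 - ?b\<^sup>2\<bar> \<le> 2 * (M + norm \<theta>) * dist x y" .
  qed
qed measurable

lemma abs_inner_bounded:
  assumes "P \<in> \<P>"
  shows "AE \<omega> in P. \<bar>p \<bullet> Y \<omega>\<bar> \<le> norm p * M"
  using Y_bounded[OF assms]
  by eventually_elim (rule order_trans[OF Cauchy_Schwarz_ineq2], simp add: mult_left_mono)

lemma integrable_Y:
  assumes P: "P \<in> \<P>"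
  shows "integrable P Y"
proof -
  interpret prob_space P using P by (rule measures_prob_space)
  show ?thesis
    by (rule integrable_const_bound[OF Y_bounded[OF P]]) (rule measures_measurable[OF P Y_measurable])
qed

text \<open>Every integral lies below the supremum that \<open>extension\<close> is. Thus the true
  mean under \<open>P\<close> is an admissible selection, and it can be used to centre the vector
  under \<open>P\<close>.\<close>

lemma expectation_in_mean_set:
  assumes P: "P \<in> \<P>"
  shows "(\<integral>\<omega>. Y \<omega> \<partial>P) \<in> mean_set \<P> E Y"
  unfolding mean_set_def
proof (intro CollectI allI)
  fix p
  have "(\<integral>\<omega>. Y \<omega> \<partial>P) \<bullet> p = (\<integral>\<omega>. p \<bullet> Y \<omega> \<partial>P)"
    using integrable_Y[OF P] by (simp add: inner_commute)
  also have "\<dots> \<le> extension \<P> E (\<lambda>\<omega>. p \<bullet> Y \<omega>)"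
    by (rule integral_le_extension[OF inner_Lp_space abs_inner_bounded P])
  finally show "(\<integral>\<omega>. Y \<omega> \<partial>P) \<bullet> p \<le> extension \<P> E (\<lambda>\<omega>. p \<bullet> Y \<omega>)" .
qed

text \<open>The defining inequality is tested in the direction \<open>p = \<theta>\<close> itself,
  where its right-hand side is at most \<open>norm \<theta> * M\<close>.\<close>

lemma norm_mean_set_le:
  assumes "\<theta> \<in> mean_set \<P> E Y"
  shows "norm \<theta> \<le> M"
proof -
  have "(\<integral>\<omega>. \<theta> \<bullet> Y \<omega> \<partial>P) \<le> norm \<theta> * M" if P: "P \<in> \<P>" for P
    using bounded_integral_le(2)[OF P _ abs_inner_bounded[OF P], of \<theta>] inner_Lp_space[of \<theta>]
    by (simp add: Lp_space_def)
  then have "extension \<P> E (\<lambda>\<omega>. \<theta> \<bullet> Y \<omega>) \<le> norm \<theta> * M"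
    by (rule extension_le[OF inner_Lp_space])
  moreover have "\<theta> \<bullet> \<theta> \<le> extension \<P> E (\<lambda>\<omega>. \<theta> \<bullet> Y \<omega>)"
    using assms by (simp add: mean_set_def)
  ultimately have "norm \<theta> * norm \<theta> \<le> norm \<theta> * M"
    by (simp add: power2_norm_eq_inner[symmetric] power2_eq_square)
  then show ?thesis using M_nonneg by (cases "\<theta> = 0") auto
qed

text \<open>The mean under \<open>P\<close> minimises the second moment of
  \<open>q \<bullet> (Y - \<theta>)\<close> over \<open>\<theta>\<close>. Hence the variance under
  \<open>P\<close> lies below every candidate of the infimum, whichever \<open>\<theta>\<close> is
  optimal for the sublinear expectation.\<close>

lemma directional_variance_le:
  assumes P: "P \<in> \<P>" and q: "norm q \<le> 1"
  shows "(\<integral>\<omega>. (q \<bullet> (Y \<omega> - (\<integral>\<omega>. Y \<omega> \<partial>P)))\<^sup>2 \<partial>P)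
    \<le> (INF \<theta>\<in>mean_set \<P> E Y. extension \<P> E (\<lambda>\<omega>. (norm (Y \<omega> - \<theta>))\<^sup>2))"
proof (rule cINF_greatest)
  show "mean_set \<P> E Y \<noteq> {}" using expectation_in_mean_set[OF P] by blast
  fix \<theta> assume \<theta>: "\<theta> \<in> mean_set \<P> E Y"
  interpret prob_space P using P by (rule measures_prob_space)
  have [measurable]: "Y \<in> borel_measurable P" by (rule measures_measurable[OF P Y_measurable])
  define m where "m = (\<integral>\<omega>. Y \<omega> \<partial>P)"
  let ?D = "\<lambda>\<omega>. q \<bullet> (Y \<omega> - m)"
  have D: "integrable P ?D" using integrable_Y[OF P] by simp
  have D0: "(\<integral>\<omega>. ?D \<omega> \<partial>P) = 0" using integrable_Y[OF P] by (simp add: m_def prob_space)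
  have bdd: "AE \<omega> in P. \<bar>(norm (Y \<omega> - c))\<^sup>2\<bar> \<le> (M + norm c)\<^sup>2" if "P \<in> \<P>" for c P
    using Y_bounded[OF that]
  proof eventually_elim
    case (elim \<omega>)
    then have "norm (Y \<omega> - c) \<le> M + norm c"
      using norm_triangle_ineq4[of "Y \<omega>" c] by linarith
    then show ?case by (simp add: power_mono)
  qed
  have sq_le: "(q \<bullet> z)\<^sup>2 \<le> (norm z)\<^sup>2" for z
  proof -
    have "\<bar>q \<bullet> z\<bar> \<le> norm q * norm z" by (rule Cauchy_Schwarz_ineq2)
    also have "\<dots> \<le> 1 * norm z" using q by (intro mult_right_mono) auto
    finally show ?thesis by (simp flip: abs_le_square_iff)
  qed
  have int_sq: "integrable P (\<lambda>\<omega>. (norm (Y \<omega> - c))\<^sup>2)" for c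
    by (rule integrable_const_bound[where B="(M + norm c)\<^sup>2"]) (use bdd[OF P] in auto)
  have int_q: "integrable P (\<lambda>\<omega>. (q \<bullet> (Y \<omega> - c))\<^sup>2)" for c
    by (rule Bochner_Integration.integrable_bound[OF int_sq[of c]]) (simp_all add: sq_le)
  have "(\<integral>\<omega>. (?D \<omega>)\<^sup>2 \<partial>P) \<le> (\<integral>\<omega>. (?D \<omega>)\<^sup>2 \<partial>P) + (q \<bullet> (m - \<theta>))\<^sup>2" by simp
  \<comment> \<open>The cross term integrates to 0, since \<open>?D\<close> has mean zero; it
    completes the square to that of \<open>q \<bullet> (Y \<omega> - \<theta>)\<close>.\<close>
  also have "\<dots> = (\<integral>\<omega>. (?D \<omega>)\<^sup>2 + 2 * (q \<bullet> (m - \<theta>)) * ?D \<omega> + (q \<bullet> (m - \<theta>))\<^sup>2 \<partial>P)"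
    using D D0 int_q[of m] by (simp add: prob_space)
  also have "\<dots> = (\<integral>\<omega>. (q \<bullet> (Y \<omega> - \<theta>))\<^sup>2 \<partial>P)"
    by (intro Bochner_Integration.integral_cong refl) (simp add: inner_diff_right power2_eq_square algebra_simps)
  also have "\<dots> \<le> (\<integral>\<omega>. (norm (Y \<omega> - \<theta>))\<^sup>2 \<partial>P)"
    by (intro integral_mono int_q int_sq sq_le)
  also have "\<dots> \<le> extension \<P> E (\<lambda>\<omega>. (norm (Y \<omega> - \<theta>))\<^sup>2)"
    by (rule integral_le_extension[OF square_dist_Lp_space bdd P])
  finally show "(\<integral>\<omega>. (q \<bullet> (Y \<omega> - (\<integral>\<omega>. Y \<omega> \<partial>P)))\<^sup>2 \<partial>P) \<le> extension \<P> E (\<lambda>\<omega>. (norm (Y \<omega> - \<theta>))\<^sup>2)"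
    by (simp add: m_def)
qed

text \<open>The range is \<open>2 * M\<close> because \<open>Y\<close> (almost surely) and its mean
  under \<open>P\<close> both have norm at most \<open>M\<close>.\<close>

lemma integral_exp_le_bernstein:
  assumes P: "P \<in> \<P>" and q: "norm q \<le> 1" and l: "0 \<le> l" "l * (2 * M) < 3"
    and v: "(INF \<theta>\<in>mean_set \<P> E Y. extension \<P> E (\<lambda>\<omega>. (norm (Y \<omega> - \<theta>))\<^sup>2)) \<le> v"
  shows "(\<integral>\<omega>. exp (l * (q \<bullet> (Y \<omega> - (\<integral>\<omega>. Y \<omega> \<partial>P)))) \<partial>P)
    \<le> exp (l\<^sup>2 * v / (2 * (1 - l * (2 * M) / 3)))"
proof -
  interpret prob_space P using P by (rule measures_prob_space)
  have [measurable]: "Y \<in> borel_measurable P" by (rule measures_measurable[OF P Y_measurable])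
  define m where "m = (\<integral>\<omega>. Y \<omega> \<partial>P)"
  have m: "norm m \<le> M"
    unfolding m_def by (rule norm_mean_set_le[OF expectation_in_mean_set[OF P]])
  show ?thesis
    unfolding m_def[symmetric]
  proof (rule expectation_exp_le_bernstein[OF _ _ _ _ l])
    show "AE \<omega> in P. \<bar>q \<bullet> (Y \<omega> - m)\<bar> \<le> 2 * M"
      using Y_bounded[OF P]
    proof eventually_elim
      case (elim \<omega>)
      have "\<bar>q \<bullet> (Y \<omega> - m)\<bar> \<le> norm q * norm (Y \<omega> - m)" by (rule Cauchy_Schwarz_ineq2)
      also have "\<dots> \<le> 1 * (2 * M)"
        using q elim m norm_triangle_ineq4[of "Y \<omega>" m] by (intro mult_mono) auto
      finally show ?case by simp
    qed
    show "expectation (\<lambda>\<omega>. q \<bullet> (Y \<omega> - m)) = 0"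
      using integrable_Y[OF P] by (simp add: m_def prob_space)
    show "expectation (\<lambda>\<omega>. (q \<bullet> (Y \<omega> - m))\<^sup>2) \<le> v"
      using directional_variance_le[OF P q] v by (simp add: m_def)
  qed measurable
qed

end

section \<open>The potential of an independent sequence\<close>

text \<open>A stand-in for the exponential of the largest \<open>l * (q \<bullet> y)\<close> over
  the net. Being a sum, it can be integrated direction by direction.\<close>

definition exp_sum :: "'b::real_inner set \<Rightarrow> real \<Rightarrow> 'b \<Rightarrow> real" where
  "exp_sum N l y = (\<Sum>q\<in>N. exp (l * (q \<bullet> y)))"

lemma exp_sum_nonneg: "0 \<le> exp_sum N l y"
  by (simp add: exp_sum_def sum_nonneg)

lemma exp_sum_add: "exp_sum N l (y + z) = (\<Sum>q\<in>N. exp (l * (q \<bullet> y)) * exp (l * (q \<bullet> z)))"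
  by (simp add: exp_sum_def inner_add_right distrib_left exp_add)

lemma mult_inner_le:
  fixes q y :: "'b::real_inner"
  assumes "norm q \<le> 1" "norm y \<le> r" "0 \<le> l"
  shows "\<bar>l * (q \<bullet> y)\<bar> \<le> l * r"
proof -
  have "\<bar>q \<bullet> y\<bar> \<le> norm q * norm y" by (rule Cauchy_Schwarz_ineq2)
  also have "\<dots> \<le> 1 * r" using assms by (intro mult_mono) auto
  finally show ?thesis using assms by (simp add: abs_mult mult_left_mono)
qed

lemma exp_sum_le:
  assumes "N \<subseteq> cball 0 1" "norm y \<le> r" "0 \<le> l"
  shows "exp_sum N l y \<le> card N * exp (l * r)"
  unfolding exp_sum_def
proof (rule sum_bounded_above)
  fix q assume "q \<in> N"
  then show "exp (l * (q \<bullet> y)) \<le> exp (l * r)"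
    using mult_inner_le[of q y r l] assms by auto
qed

lemma abs_exp_sum_diff_le:
  assumes N: "N \<subseteq> cball 0 1" and l: "0 \<le> l" and y: "norm y \<le> r" and z: "norm z \<le> r"
  shows "\<bar>exp_sum N l y - exp_sum N l z\<bar> \<le> card N * (exp (l * r) * l) * norm (y - z)"
proof -
  have "\<bar>exp_sum N l y - exp_sum N l z\<bar> \<le> (\<Sum>q\<in>N. \<bar>exp (l * (q \<bullet> y)) - exp (l * (q \<bullet> z))\<bar>)"
    unfolding exp_sum_def sum_subtractf[symmetric] by (rule sum_abs)
  also have "\<dots> \<le> card N * (exp (l * r) * (l * norm (y - z)))"
  proof (rule sum_bounded_above)
    fix q assume "q \<in> N"
    then have q: "norm q \<le> 1" using N by auto
    have "\<bar>exp (l * (q \<bullet> y)) - exp (l * (q \<bullet> z))\<bar> \<le> exp (l * r) * \<bar>l * (q \<bullet> y) - l * (q \<bullet> z)\<bar>"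
      using mult_inner_le[OF q y l] mult_inner_le[OF q z l] by (intro abs_exp_diff_le) auto
    also have "l * (q \<bullet> y) - l * (q \<bullet> z) = l * (q \<bullet> (y - z))"
      by (simp add: inner_diff_right right_diff_distrib)
    also have "exp (l * r) * \<bar>l * (q \<bullet> (y - z))\<bar> \<le> exp (l * r) * (l * norm (y - z))"
      by (intro mult_left_mono mult_inner_le[OF q _ l]) auto
    finally show "\<bar>exp (l * (q \<bullet> y)) - exp (l * (q \<bullet> z))\<bar> \<le> exp (l * r) * (l * norm (y - z))" .
  qed
  finally show ?thesis by (simp add: mult.assoc)
qed

section \<open>Selections of means and the potential\<close>

locale bounded_independent_vectors = represented_expectation \<P> E
  for \<P> :: "'a::metric_space measure set" and E :: "('a \<Rightarrow> real) \<Rightarrow> real" +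
  fixes X :: "nat \<Rightarrow> 'a \<Rightarrow> real^'d" and n :: nat and M :: real
  assumes X_Lp: "\<And>i. i \<in> {1..n} \<Longrightarrow> X i \<in> Lp_space_vec \<P> 2"
    and indep: "independent_seq \<P> E n X"
    and M_pos: "0 < M"
    and X_bounded: "\<And>i P. i \<in> {1..n} \<Longrightarrow> P \<in> \<P> \<Longrightarrow> AE \<omega> in P. norm (X i \<omega>) \<le> M"
begin

lemma bounded_vector: "i \<in> {1..n} \<Longrightarrow> bounded_vector \<P> E (X i) M"
  by unfold_locales (use X_Lp X_bounded M_pos in auto)

text \<open>The sums are not averaged, so that passing to the next index just adds one
  vector.\<close>

definition mean_sums :: "nat \<Rightarrow> (real^'d) set" where
  "mean_sums k = {\<Sum>i=1..k. \<theta> i | \<theta>. \<forall>i\<in>{1..k}. \<theta> i \<in> mean_set \<P> E (X i)}"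

lemma mean_sums_0 [simp]: "mean_sums 0 = {0}"
  by (simp add: mean_sums_def)

lemma mean_sums_Suc:
  assumes \<tau>: "\<tau> \<in> mean_sums k" and \<theta>: "\<theta> \<in> mean_set \<P> E (X (Suc k))"
  shows "\<tau> + \<theta> \<in> mean_sums (Suc k)"
proof -
  obtain t where t: "\<tau> = (\<Sum>i=1..k. t i)" "\<forall>i\<in>{1..k}. t i \<in> mean_set \<P> E (X i)"
    using \<tau> by (auto simp: mean_sums_def)
  define u where "u = t(Suc k := \<theta>)"
  have "\<forall>i\<in>{1..Suc k}. u i \<in> mean_set \<P> E (X i)"
    using t(2) \<theta> by (auto simp: u_def)
  moreover have "(\<Sum>i=1..k. u i) = \<tau>"
    unfolding t(1) by (intro sum.cong) (auto simp: u_def)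
  then have "\<tau> + \<theta> = (\<Sum>i=1..Suc k. u i)"
    by (simp add: u_def)
  ultimately show ?thesis unfolding mean_sums_def by blast
qed

lemma mean_sums_nonempty: "k \<le> n \<Longrightarrow> mean_sums k \<noteq> {}"
proof (induction k)
  case (Suc k)
  interpret bounded_vector \<P> E "X (Suc k)" M
    using Suc by (intro bounded_vector) auto
  obtain P where "P \<in> \<P>" using measures_nonempty by blast
  from mean_sums_Suc[OF _ expectation_in_mean_set[OF this]] Suc show ?case by fastforce
qed simp

lemma norm_mean_sums_le:
  assumes k: "k \<le> n" and \<tau>: "\<tau> \<in> mean_sums k"
  shows "norm \<tau> \<le> k * M"
proof -
  obtain t where t: "\<tau> = (\<Sum>i=1..k. t i)" "\<forall>i\<in>{1..k}. t i \<in> mean_set \<P> E (X i)"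
    using \<tau> by (auto simp: mean_sums_def)
  have "norm (t i) \<le> M" if i: "i \<in> {1..k}" for i
  proof -
    interpret bounded_vector \<P> E "X i" M
      using i k by (intro bounded_vector) auto
    show ?thesis using t(2) i by (intro norm_mean_set_le) auto
  qed
  then have "norm \<tau> \<le> (\<Sum>i=1..k. M)" unfolding t(1) by (rule sum_norm_le)
  then show ?thesis by simp
qed

text \<open>Taking the infimum over all selections of means lets a single function of the \<open>X i\<close> serve
  every \<open>P \<in> \<P>\<close>: at each step one inserts the mean of the next vector under the measure at hand.
  Clipping makes the function bounded and Lipschitz, so that independence applies to it.\<close>

definition potential :: "(real^'d) set \<Rightarrow> real \<Rightarrow> nat \<Rightarrow> (nat \<Rightarrow> real^'d) \<Rightarrow> real" where
  "potential N l k x = (INF \<tau>\<in>mean_sums k. exp_sum N l ((\<Sum>j=1..k. clip M (x j)) - \<tau>))"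

lemma potential_0: "potential N l 0 x = card N"
  by (simp add: potential_def exp_sum_def)

lemma bdd_below_exp_sum: "bdd_below ((\<lambda>\<tau>. exp_sum N l (f \<tau>)) ` T)"
  by (rule bdd_belowI2[of _ 0]) (rule exp_sum_nonneg)

lemma potential_nonneg: "k \<le> n \<Longrightarrow> 0 \<le> potential N l k x"
  unfolding potential_def by (intro cINF_greatest mean_sums_nonempty exp_sum_nonneg)

lemma potential_le: "\<tau> \<in> mean_sums k \<Longrightarrow> potential N l k x \<le> exp_sum N l ((\<Sum>j=1..k. clip M (x j)) - \<tau>)"
  unfolding potential_def by (intro cINF_lower bdd_below_exp_sum)

text \<open>Clipped sums and sums of means both have norm at most \<open>k * M\<close>. All
  arguments of \<open>exp_sum\<close> thus stay in the ball of radius \<open>2 * (k * M)\<close>,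
  where one Lipschitz constant serves every \<open>\<tau>\<close> and hence the infimum.\<close>

lemma potential_cb_Lip_prefix:
  assumes N: "N \<subseteq> cball 0 1" and l: "0 \<le> l" and k: "k \<le> n"
  shows "potential N l k \<in> cb_Lip_prefix k"
proof -
  define s where "s x = (\<Sum>j=1..k. clip M (x j))" for x :: "nat \<Rightarrow> real^'d"
  have "norm (s x) \<le> (\<Sum>j=1..k. M)" for x
    unfolding s_def using M_pos by (intro sum_norm_le norm_clip_le) auto
  then have "norm (s x) \<le> k * M" for x by simp
  then have norm_le: "norm (s x - \<tau>) \<le> 2 * (k * M)" if "\<tau> \<in> mean_sums k" for x \<tau>
    using norm_triangle_ineq4[of "s x" \<tau>] norm_mean_sums_le[OF k that] by (smt (verit))
  let ?L = "card N * (exp (l * (2 * (k * M))) * l)"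
  show ?thesis
  proof (rule cb_Lip_prefixI)
    show "0 \<le> ?L" using l by simp
    show "\<bar>potential N l k x\<bar> \<le> card N * exp (l * (2 * (k * M)))" for x
    proof -
      obtain \<tau> where \<tau>: "\<tau> \<in> mean_sums k" using mean_sums_nonempty[OF k] by blast
      have "potential N l k x \<le> exp_sum N l (s x - \<tau>)"
        unfolding s_def using \<tau> by (rule potential_le)
      also have "\<dots> \<le> card N * exp (l * (2 * (k * M)))"
        by (rule exp_sum_le[OF N norm_le[OF \<tau>] l])
      finally show ?thesis using potential_nonneg[OF k] by simp
    qed
    fix x y :: "nat \<Rightarrow> real^'d"
    have "norm (s x - s y) \<le> (\<Sum>j=1..k. norm (x j - y j))"
      unfolding s_def sum_subtractf[symmetric]
      using M_pos by (intro sum_norm_le norm_clip_diff_le) auto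
    then have le: "?L * norm (s x - s y) \<le> ?L * (\<Sum>j=1..k. norm (x j - y j))"
      using l by (intro mult_left_mono) auto
    show "\<bar>potential N l k x - potential N l k y\<bar> \<le> ?L * (\<Sum>j=1..k. norm (x j - y j))"
      unfolding potential_def s_def[symmetric]
    proof (rule abs_cINF_diff_le[OF mean_sums_nonempty[OF k] bdd_below_exp_sum bdd_below_exp_sum])
      fix \<tau> assume \<tau>: "\<tau> \<in> mean_sums k"
      have "\<bar>exp_sum N l (s x - \<tau>) - exp_sum N l (s y - \<tau>)\<bar> \<le> ?L * norm ((s x - \<tau>) - (s y - \<tau>))"
        by (rule abs_exp_sum_diff_le[OF N l norm_le[OF \<tau>] norm_le[OF \<tau>]])
      then show "\<bar>exp_sum N l (s x - \<tau>) - exp_sum N l (s y - \<tau>)\<bar> \<le> ?L * (\<Sum>j=1..k. norm (x j - y j))"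
        using le by simp
    qed
  qed
qed

text \<open>Any selection \<open>\<tau>\<close> for the first \<open>k\<close> vectors extends by
  the mean of the next vector under \<open>P\<close>. With this choice each direction contributes
  its frozen exponential times a centred exponential moment, which is at most
  \<open>C\<close>.\<close>

lemma potential_step:
  fixes C :: real
  assumes N: "N \<subseteq> cball 0 1" "finite N" and l: "0 \<le> l" and k: "Suc k \<le> n" and P: "P \<in> \<P>" and C: "0 < C"
    and mgf: "\<And>q. q \<in> N \<Longrightarrow>
      (\<integral>\<omega>. exp (l * (q \<bullet> (X (Suc k) \<omega> - (\<integral>\<omega>. X (Suc k) \<omega> \<partial>P)))) \<partial>P) \<le> C"
  shows "(\<integral>\<omega>. potential N l (Suc k) (x(Suc k := X (Suc k) \<omega>)) \<partial>P) \<le> C * potential N l k x"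
proof -
  interpret bounded_vector \<P> E "X (Suc k)" M
    using k by (intro bounded_vector) auto
  interpret prob_space P using P by (rule measures_prob_space)
  define m where "m = (\<integral>\<omega>. X (Suc k) \<omega> \<partial>P)"
  have m: "m \<in> mean_set \<P> E (X (Suc k))"
    unfolding m_def using P by (rule expectation_in_mean_set)
  have [measurable]: "X (Suc k) \<in> borel_measurable P" by (rule measures_measurable[OF P Y_measurable])
  let ?Z = "\<lambda>\<omega>. potential N l (Suc k) (x(Suc k := X (Suc k) \<omega>))"
  note pot = potential_cb_Lip_prefix[OF N(1) l k]
  have Zm: "?Z \<in> borel_measurable borel"
    using cb_Lip_comp_Lp_space[OF cb_Lip_prefix_update[OF pot] X_Lp, of "Suc k" "Suc k" x] k
    by (auto simp: Lp_space_def)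
  obtain B where B: "\<And>x. \<bar>potential N l (Suc k) x\<bar> \<le> B" using cb_Lip_prefixE[OF pot] by metis
  have Zi: "integrable P ?Z"
    by (rule bounded_integral_le(1)[OF P Zm, where B=B]) (simp add: B)
  \<comment> \<open>Dividing by \<open>C\<close> isolates the infimum on the right, so that each
    \<open>\<tau>\<close> can be treated on its own.\<close>
  have "(\<integral>\<omega>. ?Z \<omega> \<partial>P) / C \<le> potential N l k x"
    unfolding potential_def[of N l k x]
  proof (rule cINF_greatest)
    show "mean_sums k \<noteq> {}" using k by (intro mean_sums_nonempty) auto
    fix \<tau> assume \<tau>: "\<tau> \<in> mean_sums k"
    define y where "y = (\<Sum>j=1..k. clip M (x j)) - \<tau>"
    have int: "integrable P (\<lambda>\<omega>. exp (l * (q \<bullet> (X (Suc k) \<omega> - m))))" if "q \<in> N" for q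
    proof (rule integrable_const_bound)
      show "AE \<omega> in P. norm (exp (l * (q \<bullet> (X (Suc k) \<omega> - m)))) \<le> exp (l * (M + norm m))"
        using Y_bounded[OF P]
      proof eventually_elim
        case (elim \<omega>)
        have "norm (X (Suc k) \<omega> - m) \<le> M + norm m"
          using norm_triangle_ineq4[of "X (Suc k) \<omega>" m] elim by linarith
        from mult_inner_le[OF _ this l, of q] that N show ?case by auto
      qed
    qed measurable
    have "(\<integral>\<omega>. ?Z \<omega> \<partial>P) \<le> (\<integral>\<omega>. exp_sum N l (y + (X (Suc k) \<omega> - m)) \<partial>P)"
    proof (rule integral_mono_AE[OF Zi])
      show "integrable P (\<lambda>\<omega>. exp_sum N l (y + (X (Suc k) \<omega> - m)))"
        unfolding exp_sum_add using int by simp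
      show "AE \<omega> in P. ?Z \<omega> \<le> exp_sum N l (y + (X (Suc k) \<omega> - m))"
        using Y_bounded[OF P]
      proof eventually_elim
        case (elim \<omega>)
        have "(\<Sum>j=1..k. clip M ((x(Suc k := X (Suc k) \<omega>)) j)) = (\<Sum>j=1..k. clip M (x j))"
          by (intro sum.cong) auto
        then have eq: "(\<Sum>j=1..Suc k. clip M ((x(Suc k := X (Suc k) \<omega>)) j)) - (\<tau> + m) = y + (X (Suc k) \<omega> - m)"
          using elim by (simp add: y_def clip_eq)
        \<comment> \<open>The infimum in the potential is bounded by its value at
          \<open>\<tau> + m\<close>, which centres the new vector under \<open>P\<close>.\<close>
        have "?Z \<omega> \<le> exp_sum N l ((\<Sum>j=1..Suc k. clip M ((x(Suc k := X (Suc k) \<omega>)) j)) - (\<tau> + m))"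
          by (rule potential_le[OF mean_sums_Suc[OF \<tau> m]])
        also note eq
        finally show ?case .
      qed
    qed
    also have "\<dots> = (\<Sum>q\<in>N. exp (l * (q \<bullet> y)) * (\<integral>\<omega>. exp (l * (q \<bullet> (X (Suc k) \<omega> - m))) \<partial>P))"
      unfolding exp_sum_add using int by simp
    also have "\<dots> \<le> (\<Sum>q\<in>N. exp (l * (q \<bullet> y)) * C)"
      using mgf by (intro sum_mono mult_left_mono) (auto simp: m_def)
    also have "\<dots> = exp_sum N l y * C"
      by (simp add: exp_sum_def sum_distrib_right)
    finally show "(\<integral>\<omega>. ?Z \<omega> \<partial>P) / C \<le> exp_sum N l ((\<Sum>j=1..k. clip M (x j)) - \<tau>)"
      using C by (simp add: y_def divide_simps)
  qed
  then show ?thesis using C by (simp add: divide_simps mult.commute)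
qed

text \<open>Each induction step uses independence to integrate the last vector with the earlier ones
  frozen, at the price of a factor \<open>C\<close>. The start is the constant
  \<open>card N\<close>.\<close>

lemma integral_potential_le:
  fixes C :: real
  assumes N: "N \<subseteq> cball 0 1" "finite N" and l: "0 \<le> l" and C: "0 < C"
    and mgf: "\<And>q i P. q \<in> N \<Longrightarrow> i \<in> {1..n} \<Longrightarrow> P \<in> \<P> \<Longrightarrow>
      (\<integral>\<omega>. exp (l * (q \<bullet> (X i \<omega> - (\<integral>\<omega>. X i \<omega> \<partial>P)))) \<partial>P) \<le> C"
  shows "k \<le> n \<Longrightarrow> P \<in> \<P> \<Longrightarrow> (\<integral>\<omega>. potential N l k (\<lambda>j. X j \<omega>) \<partial>P) \<le> C ^ k * card N"
\<comment> \<open>The outer expectation in the definition of independence is a supremum over all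
  measures, so the induction hypothesis is needed for each of them.\<close>
proof (induction k arbitrary: P)
  case 0
  interpret prob_space P using 0(2) by (rule measures_prob_space)
  show ?case by (simp add: potential_0 prob_space)
next
  case (Suc k)
  note pot = potential_cb_Lip_prefix[OF N(1) l Suc.prems(1)]
  obtain B where B: "\<And>x. \<bar>potential N l (Suc k) x\<bar> \<le> B" using cb_Lip_prefixE[OF pot] by metis
  have step: "(\<integral>\<omega>. potential N l (Suc k) (x(Suc k := X (Suc k) \<omega>)) \<partial>P) \<le> C * potential N l k x"
    if "P \<in> \<P>" for x P
    using Suc.prems that by (intro potential_step[OF N l _ _ C] mgf) auto
  show ?case
  proof (cases "k = 0")
    case True
    have "potential N l (Suc k) (\<lambda>j. X j \<omega>) = potential N l (Suc k) ((\<lambda>_. 0)(Suc k := X (Suc k) \<omega>))" for \<omega>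
      by (simp add: True potential_def)
    then show ?thesis using step[OF Suc.prems(2), of "\<lambda>_. 0"] by (simp add: True potential_0)
  next
    case False
    let ?G = "\<lambda>x. extension \<P> E (\<lambda>\<omega>. potential N l (Suc k) (x(Suc k := X (Suc k) \<omega>)))"
    have Lp: "(\<lambda>\<omega>. potential N l (Suc k) (x(Suc k := X (Suc k) \<omega>))) \<in> Lp_space \<P> 1" for x
      by (rule cb_Lip_comp_Lp_space[OF cb_Lip_prefix_update[OF pot] X_Lp]) (use Suc.prems in auto)
    \<comment> \<open>The step bound holds under every measure for one and the same right-hand side,
      hence also for the supremum over the measures.\<close>
    have G_le: "?G x \<le> C * potential N l k x" for x
      by (rule extension_le[OF Lp step])
    have Xk: "j \<in> {1..k} \<Longrightarrow> X j \<in> Lp_space_vec \<P> 2" for j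
      using Suc.prems by (intro X_Lp) auto
    have pG: "?G \<in> cb_Lip_prefix k"
      by (rule extension_update_prefix[OF pot X_Lp]) (use Suc.prems in auto)
    then have GLp: "(\<lambda>\<omega>. ?G (\<lambda>j. X j \<omega>)) \<in> Lp_space \<P> 1"
      by (rule cb_Lip_prefix_comp_Lp_space) (rule Xk)
    obtain BG where BG: "\<And>x. \<bar>?G x\<bar> \<le> BG" using cb_Lip_prefixE[OF pG] by metis
    have pk: "potential N l k \<in> cb_Lip_prefix k"
      using Suc.prems by (intro potential_cb_Lip_prefix N l) simp
    obtain Bk where Bk: "\<And>x. \<bar>potential N l k x\<bar> \<le> Bk" using cb_Lip_prefixE[OF pk] by metis
    have "(\<integral>\<omega>. potential N l (Suc k) (\<lambda>j. X j \<omega>) \<partial>P)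
        \<le> extension \<P> E (\<lambda>\<omega>. potential N l (Suc k) (\<lambda>j. X j \<omega>))"
    proof (rule integral_le_extension[OF _ _ Suc.prems(2)])
      show "(\<lambda>\<omega>. potential N l (Suc k) (\<lambda>j. X j \<omega>)) \<in> Lp_space \<P> 1"
        by (rule cb_Lip_prefix_comp_Lp_space[OF pot X_Lp]) (use Suc.prems in auto)
    qed (use B in auto)
    \<comment> \<open>Independence at index \<open>k\<close>: \<open>X (Suc k)\<close> is integrated
      first, with the vectors before it frozen.\<close>
    also have "\<dots> = extension \<P> E (\<lambda>\<omega>. ?G (\<lambda>j. X j \<omega>))"
      using indep[unfolded independent_seq_def, rule_format, of k "potential N l (Suc k)"] False Suc.prems pot
      by simp
    also have "\<dots> \<le> C ^ Suc k * card N"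
    proof (rule extension_le[OF GLp])
      fix Q assume Q: "Q \<in> \<P>"
      have "(\<integral>\<omega>. ?G (\<lambda>j. X j \<omega>) \<partial>Q) \<le> (\<integral>\<omega>. C * potential N l k (\<lambda>j. X j \<omega>) \<partial>Q)"
      proof (intro integral_mono)
        show "integrable Q (\<lambda>\<omega>. ?G (\<lambda>j. X j \<omega>))"
          by (rule bounded_integral_le(1)[OF Q, where B=BG]) (use GLp BG in \<open>auto simp: Lp_space_def\<close>)
        have "(\<lambda>\<omega>. potential N l k (\<lambda>j. X j \<omega>)) \<in> borel_measurable borel"
          using cb_Lip_prefix_comp_Lp_space[OF pk Xk] by (simp add: Lp_space_def)
        then have "integrable Q (\<lambda>\<omega>. potential N l k (\<lambda>j. X j \<omega>))"
          by (rule bounded_integral_le(1)[OF Q, where B=Bk]) (simp add: Bk)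
        then show "integrable Q (\<lambda>\<omega>. C * potential N l k (\<lambda>j. X j \<omega>))" by simp
      qed (rule G_le)
      also have "\<dots> = C * (\<integral>\<omega>. potential N l k (\<lambda>j. X j \<omega>) \<partial>Q)" by simp
      also have "\<dots> \<le> C * (C ^ k * card N)"
        using C Suc.IH[OF _ Q] Suc.prems by (intro mult_left_mono) auto
      finally show "(\<integral>\<omega>. ?G (\<lambda>j. X j \<omega>) \<partial>Q) \<le> C ^ Suc k * card N" by simp
    qed
    finally show ?thesis .
  qed
qed

section \<open>From the potential to deviation probabilities\<close>

lemma avg_mean_set_eq: "avg_mean_set \<P> E n X = (\<lambda>\<tau>. (1 / real n) *\<^sub>R \<tau>) ` mean_sums n"
  unfolding avg_mean_set_def mean_sums_def by blast

lemma measure_deviation_le: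
  fixes C t :: real
  assumes N: "N \<subseteq> cball 0 1" "finite N" and net: "\<And>y. \<exists>q\<in>N. norm y / 2 \<le> q \<bullet> y"
    and l: "0 \<le> l" and C: "0 < C" and n: "1 \<le> n" and P: "P \<in> \<P>"
    and mgf: "\<And>q i P. q \<in> N \<Longrightarrow> i \<in> {1..n} \<Longrightarrow> P \<in> \<P> \<Longrightarrow>
      (\<integral>\<omega>. exp (l * (q \<bullet> (X i \<omega> - (\<integral>\<omega>. X i \<omega> \<partial>P)))) \<partial>P) \<le> C"
  shows "measure P {\<omega>. infdist ((1 / real n) *\<^sub>R (\<Sum>i=1..n. X i \<omega>)) (avg_mean_set \<P> E n X) > t}
    \<le> C ^ n * card N / exp (l * (n * t / 2))"
proof -
  interpret prob_space P using P by (rule measures_prob_space)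
  let ?Z = "\<lambda>\<omega>. potential N l n (\<lambda>j. X j \<omega>)" and ?c = "exp (l * (n * t / 2))"
  let ?A = "{\<omega>. infdist ((1 / real n) *\<^sub>R (\<Sum>i=1..n. X i \<omega>)) (avg_mean_set \<P> E n X) > t}"
  have sp: "space P = UNIV" using sets_eq_imp_space_eq[OF sets_measures[OF P]] by simp
  note pot = potential_cb_Lip_prefix[OF N(1) l order_refl]
  have Zm: "?Z \<in> borel_measurable borel"
    using cb_Lip_prefix_comp_Lp_space[OF pot X_Lp] by (simp add: Lp_space_def)
  have [measurable]: "?Z \<in> borel_measurable P" by (rule measures_measurable[OF P Zm])
  obtain B where B: "\<And>x. \<bar>potential N l n x\<bar> \<le> B" using cb_Lip_prefixE[OF pot] by metis
  have Zi: "integrable P ?Z"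
    by (rule bounded_integral_le(1)[OF P Zm, where B=B]) (simp add: B)
  have "AE \<omega> in P. \<forall>i\<in>{1..n}. norm (X i \<omega>) \<le> M"
    using X_bounded[OF _ P] by (intro AE_finite_allI) auto
  \<comment> \<open>The inclusion of events is almost sure only, because the potential is built from
    clipped vectors.\<close>
  then have "AE \<omega> in P. \<omega> \<in> ?A \<longrightarrow> \<omega> \<in> {\<omega>\<in>space P. ?Z \<omega> \<ge> ?c}"
  proof eventually_elim
    case (elim \<omega>)
    let ?s = "\<Sum>i=1..n. X i \<omega>"
    have clip: "(\<Sum>j=1..n. clip M (X j \<omega>)) = ?s" using elim by (intro sum.cong) (auto simp: clip_eq)
    have "?c \<le> ?Z \<omega>" if A: "\<omega> \<in> ?A"
      unfolding potential_def clip
    proof (rule cINF_greatest[OF mean_sums_nonempty[OF order_refl]])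
      fix \<tau> assume \<tau>: "\<tau> \<in> mean_sums n"
      \<comment> \<open>A distance to the set above \<open>t\<close> means a distance above
        \<open>t\<close> to each of its points, in particular to the scaled
        \<open>\<tau>\<close>.\<close>
      have "t < dist ((1 / real n) *\<^sub>R ?s) ((1 / real n) *\<^sub>R \<tau>)"
        using A \<tau> by (auto simp: avg_mean_set_eq intro: less_le_trans infdist_le)
      also have "\<dots> = norm (?s - \<tau>) / n"
        by (simp add: dist_norm scaleR_diff_right[symmetric])
      finally have "n * t \<le> norm (?s - \<tau>)" using n by (simp add: field_simps)
      moreover obtain q where q: "q \<in> N" "norm (?s - \<tau>) / 2 \<le> q \<bullet> (?s - \<tau>)" using net by blast
      ultimately have "n * t / 2 \<le> q \<bullet> (?s - \<tau>)" by linarith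
      then have "?c \<le> exp (l * (q \<bullet> (?s - \<tau>)))"
        using l by (simp only: exp_le_cancel_iff mult_left_mono)
      also have "\<dots> \<le> exp_sum N l (?s - \<tau>)"
        unfolding exp_sum_def using N q(1) by (intro member_le_sum) auto
      finally show "?c \<le> exp_sum N l (?s - \<tau>)" .
    qed
    then show ?case by (simp add: sp)
  qed
  then have "measure P ?A \<le> measure P {\<omega>\<in>space P. ?Z \<omega> \<ge> ?c}"
    by (rule finite_measure_mono_AE) measurable
  also have "\<dots> \<le> (\<integral>\<omega>. ?Z \<omega> \<partial>P) / ?c"
    by (rule integral_Markov_inequality_measure[OF Zi sets.top]) (simp_all add: potential_nonneg)
  also have "\<dots> \<le> C ^ n * card N / ?c"
    by (intro divide_right_mono integral_potential_le[OF N l C mgf] P) auto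
  finally show ?thesis .
qed

lemma variance_le_max_variance:
  assumes "i \<in> {1..n}"
  shows "(INF \<theta>\<in>mean_set \<P> E (X i). extension \<P> E (\<lambda>\<omega>. (norm (X i \<omega> - \<theta>))\<^sup>2)) \<le> max_variance \<P> E n X"
  unfolding max_variance_def using assms by (rule cSUP_upper) simp

lemma max_variance_nonneg:
  assumes "1 \<le> n"
  shows "0 \<le> max_variance \<P> E n X"
proof -
  interpret bounded_vector \<P> E "X 1" M
    using assms by (intro bounded_vector) auto
  obtain P where P: "P \<in> \<P>" using measures_nonempty by blast
  \<comment> \<open>In the direction \<open>q = 0\<close> the variance is 0, so the infimum for the
    first vector is nonnegative.\<close>
  show ?thesis
    using directional_variance_le[OF P, of 0] variance_le_max_variance[of 1] assms by simp
qed

end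

section \<open>The tail bound for the upper capacity\<close>

theorem corollary4p3:
  fixes E :: "('a::polish_space \<Rightarrow> real) \<Rightarrow> real"
    and \<P> :: "'a measure set"
    and X :: "nat \<Rightarrow> 'a \<Rightarrow> real^'d"
    and n :: nat and M t :: real
  assumes "regular_sublinear_expectation E"
    and "represents \<P> E"
    and "n \<ge> 1"
    and "\<forall>i\<in>{1..n}. X i \<in> Lp_space_vec \<P> 2"
    and "independent_seq \<P> E n X"
    and "M > 0"
    and "\<forall>i\<in>{1..n}. \<forall>P\<in>\<P>. AE \<omega> in P. norm (X i \<omega>) \<le> M"
    and "t > 0"
  shows "upper_capacity \<P>
           {\<omega>. infdist ((1 / real n) *\<^sub>R (\<Sum>i=1..n. X i \<omega>)) (avg_mean_set \<P> E n X) > t}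
         \<le> 2 * 5 ^ CARD('d) *
             exp (- (real n * t\<^sup>2 / (8 * max_variance \<P> E n X + 8 * M * t / 3)))"
proof -
  interpret bounded_independent_vectors \<P> E X n M
    by unfold_locales (use assms in \<open>auto simp: regular_sublinear_expectation_def\<close>)
  define v where "v = max_variance \<P> E n X"
  have v: "0 \<le> v" unfolding v_def using assms(3) by (rule max_variance_nonneg)
  \<comment> \<open>The exponent is optimised for the range \<open>2 * M\<close> of the centred
    vectors and for a deviation \<open>t / 2\<close> per vector, since the half-net sees only half
    of the norm.\<close>
  have M2: "0 < 2 * M" and t2: "0 < t / 2" using assms by auto
  obtain l where l: "0 < l" "l * (2 * M) < 3"
    and exponent: "l\<^sup>2 * v / (2 * (1 - l * (2 * M) / 3)) - l * (t / 2) \<le> - ((t / 2)\<^sup>2 / (2 * (v + 2 * M * (t / 2) / 3)))"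
    using bernstein_exponent[OF v M2 t2] .
  define c where "c = l\<^sup>2 * v / (2 * (1 - l * (2 * M) / 3))"
  obtain N :: "(real^'d) set" where N: "finite N" "N \<subseteq> cball 0 1" "card N \<le> 5 ^ DIM(real^'d)"
    and net: "\<And>y. \<exists>q\<in>N. norm y / 2 \<le> q \<bullet> y"
    using obtain_half_net by metis
  have mgf: "(\<integral>\<omega>. exp (l * (q \<bullet> (X i \<omega> - (\<integral>\<omega>. X i \<omega> \<partial>P)))) \<partial>P) \<le> exp c"
    if "q \<in> N" "i \<in> {1..n}" "P \<in> \<P>" for q i P
  proof -
    interpret bounded_vector \<P> E "X i" M using that(2) by (rule bounded_vector)
    show ?thesis
      unfolding c_def using that N l variance_le_max_variance[OF that(2)]
      by (intro integral_exp_le_bernstein) (auto simp: v_def)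
  qed
  show ?thesis
    unfolding upper_capacity_def
  proof (rule cSUP_least[OF measures_nonempty])
    fix P assume P: "P \<in> \<P>"
    let ?A = "{\<omega>. infdist ((1 / real n) *\<^sub>R (\<Sum>i=1..n. X i \<omega>)) (avg_mean_set \<P> E n X) > t}"
    have "measure P ?A \<le> exp c ^ n * card N / exp (l * (n * t / 2))"
      by (rule measure_deviation_le[OF N(2,1) net _ _ assms(3) P mgf]) (use l in auto)
    also have "\<dots> = card N * exp (n * (c - l * (t / 2)))"
      by (simp add: exp_of_nat_mult[symmetric] exp_diff right_diff_distrib mult_ac)
    also have "\<dots> \<le> (2 * 5 ^ CARD('d)) * exp (- (real n * t\<^sup>2 / (8 * v + 8 * M * t / 3)))"
    proof (rule mult_mono)
      have "real (card N) \<le> real (5 ^ CARD('d))" using N(3) by (subst of_nat_le_iff) simp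
      also have "\<dots> \<le> 2 * 5 ^ CARD('d)" by simp
      finally show "real (card N) \<le> 2 * 5 ^ CARD('d)" .
      \<comment> \<open>The constants 8 arise here: a factor 4 from squaring \<open>t / 2\<close>
        times the factor 2 of Bernstein's exponent.\<close>
      have "(t / 2)\<^sup>2 / (2 * (v + 2 * M * (t / 2) / 3)) = t\<^sup>2 / (8 * v + 8 * M * t / 3)"
        by (simp add: power_divide field_simps)
      then have "n * (c - l * (t / 2)) \<le> n * - (t\<^sup>2 / (8 * v + 8 * M * t / 3))"
        using exponent by (intro mult_left_mono) (auto simp: c_def)
      then show "exp (n * (c - l * (t / 2))) \<le> exp (- (real n * t\<^sup>2 / (8 * v + 8 * M * t / 3)))"
        by simp
    qed auto
    finally show "measure P ?A \<le> 2 * 5 ^ CARD('d) * exp (- (real n * t\<^sup>2 / (8 * max_variance \<P> E n X + 8 * M * t / 3)))"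
      by (simp add: v_def)
  qed
qed

end
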